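(* The dual of a Lie $2$-algebra is a Lie-quasi-Poisson groupoid. Precisely: let $\mathfrak{g}=(\mathfrak{g}_{-1}\xrightarrow{l_1}\mathfrak{g}_0,\ l_2=l_2^0+l_2^1,\ l_3)$ be a $2$-term $L_\infty$-algebra (equivalently, a Lie $2$-algebra). Then the $2$-vector space $\mathfrak{g}_{-1}^*\oplus\mathfrak{g}_0^*\rightrightarrows\mathfrak{g}_{-1}^*$ given by the dual complex $\mathfrak{g}_0^*\xrightarrow{l_1^*}\mathfrak{g}_{-1}^*$, equipped with the bivector field $\Pi$ determined by $$\Pi(dx,dy)=-l_2^0(x,y),\qquad \Pi(dx,dm)=-l_2^1(x,m),\qquad \Pi(dm,dn)=-l_2^1(l_1(m),n)$$ for $x,y\in\mathfrak{g}_0$, $m,n\in\mathfrak{g}_{-1}$ (regarded as linear functions on $\mathfrak{g}_{-1}^*\oplus\mathfrak{g}_0^*$), and with the trisection $\phi=-l_3$, is a Lie-quasi-Poisson groupoid.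
   Context: All vector spaces are real and finite-dimensional. A $2$-term $L_\infty$-algebra $(\mathfrak{g}_{-1}\xrightarrow{l_1}\mathfrak{g}_0,l_2=l_2^0+l_2^1,l_3)$ consists of a linear map $l_1:\mathfrak{g}_{-1}\to\mathfrak{g}_0$, maps $l_2^0:\wedge^2\mathfrak{g}_0\to\mathfrak{g}_0$, $l_2^1:\mathfrak{g}_0\otimes\mathfrak{g}_{-1}\to\mathfrak{g}_{-1}$ (with $l_2(m,x)=-l_2(x,m)$, $l_2(m,n)=0$) and $l_3:\wedge^3\mathfrak{g}_0\to\mathfrak{g}_{-1}$, with, for $x,y,z,x_i\in\mathfrak{g}_0$, $m,n\in\mathfrak{g}_{-1}$: $l_1l_2(x,m)=l_2(x,l_1m)$; $l_2(l_1m,n)=l_2(m,l_1n)$; $l_2(l_2(x,y),z)+c.p.+l_1l_3(x,y,z)=0$; $l_2(l_2(x,y),m)+l_2(l_2(y,m),x)+l_2(l_2(m,x),y)+l_3(x,y,l_1m)=0$; $\sum_{\sigma}\mathrm{sgn}(\sigma)l_3(l_2(x_{\sigma(1)},x_{\sigma(2)}),x_{\sigma(3)},x_{\sigma(4)})=\sum_{\tau}\mathrm{sgn}(\tau)l_2(l_3(x_{\tau(1)},x_{\tau(2)},x_{\tau(3)}),x_{\tau(4)})$, $\sigma$ over $(2,2)$- and $\tau$ over $(3,1)$-unshuffles. "$c.p.$" denotes cyclic permutations. Lie $2$-algebras form a category equivalent to that of $2$-term $L_\infty$-algebras and are identified with them. Define $l_1^*:\mathfrak{g}_0^*\to\mathfrak{g}_{-1}^*$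 by $\langle l_1^*\xi,m\rangle=-\langle\xi,l_1(m)\rangle$. A $2$-vector space is a category internal to vector spaces. A $2$-term complex $V_1\xrightarrow{\mathrm{d}}V_0$ corresponds to the $2$-vector space $V_0\oplus V_1\rightrightarrows V_0$ with $s(v+m)=v$, $t(v+m)=v+\mathrm{d}m$; it is the action Lie groupoid of the abelian group $V_1$ acting on $V_0$ by $v_0\cdot v_1=v_0+\mathrm{d}v_1$, with product $(v,m)(v+\mathrm{d}m,m')=(v,m+m')$. Its Lie algebroid is the trivial bundle $A=V_0\times V_1\to V_0$; for a section $e:V_0\to V_1$, the left and right translations are $\overleftarrow{e}_{(v,m)}=(0,e(v+\mathrm{d}m))$ and $\overrightarrow{e}_{(v,m)}=(-\mathrm{d}(e(v)),e(v))$, extended to $\Gamma(\wedge^kA)$. A quasi-Poisson groupoid is a triple $(\Gamma,\Pi,\phi)$ where $\Gamma$ is a Lie groupoid with Lie algebroid $A$, $\Pi$ is a multiplicative bivector field on $\Gamma$ and $\phi\in\Gamma(\wedge^3A)$, such that $\frac12[\Pi,\Pi]_S=\overleftarrow{\phi}-\overrightarrow{\phi}$ and $[\Pi,\overleftarrow{\phi}]_S=0$, with $[\cdot,\cdot]_S$ the Schouten bracket. A Lie-quasi-Poisson groupoid is a quasi-Poisson groupoid $(\mathbb{V},\Pi,\phi)$ with $\mathbb{V}$ a $2$-vector space such that the bivector field $\Pi$ and the trisection $\phi$ are both linear (i.e. $\Pi$ has linear coefficients in linear coordinates, and $\phi$, as a map $V_0\to\wedge^3V_1$, is linear). Here $-l_3\in\wedge^3\mathfrak{g}_0^*\otimes\mathfrak{g}_{-1}$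 is viewed as a linear map $\mathfrak{g}_{-1}^*\to\wedge^3\mathfrak{g}_0^*$. *)

theory Defs
  imports "HOL-Analysis.Analysis" "HOL-Combinatorics.Combinatorics"
begin

section \<open>Finite-dimensional real vector spaces\<close>

text \<open>
  The library class \<^class>\<open>euclidean_space\<close> excludes the zero space, which must be allowed here
  (a Lie algebra is a Lie 2-algebra with vanishing degree -1 part). A norm is only carried along to
  be able to speak of derivatives: every finite-dimensional real vector space has one, all of them
  are equivalent, and all linear maps are bounded.
\<close>

class finite_dim_space = real_normed_vector +
  assumes finite_generation: "\<exists>B. finite B \<and> (\<forall>x. \<exists>a. x = (\<Sum>b\<in>B. a b *\<^sub>R b))"

lemma generates_iff_span:
  assumes "finite (B :: 'a::real_vector set)"
  shows "(\<forall>x. \<exists>a. x = (\<Sum>b\<in>B. a b *\<^sub>R b)) \<longleftrightarrow> span B = UNIV"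
  unfolding span_finite[OF assms] by (auto simp: image_iff set_eq_iff)

lemma finite_spanning_set: "\<exists>B. finite B \<and> span B = (UNIV :: 'a::finite_dim_space set)"
  using finite_generation generates_iff_span by metis

lemma finite_dim_spaceI:
  "\<exists>B. finite B \<and> span B = (UNIV :: 'a::real_vector set) \<Longrightarrow>
    \<exists>B. finite B \<and> (\<forall>x::'a. \<exists>a. x = (\<Sum>b\<in>B. a b *\<^sub>R b))"
  using generates_iff_span by metis

lemma finite_span_of_separating_functionals:
  fixes L :: "'i \<Rightarrow> 'v::real_vector \<Rightarrow> real"
  assumes "finite I" "subspace S" "\<And>i. i \<in> I \<Longrightarrow> linear (L i)"
    "\<And>w. w \<in> S \<Longrightarrow> (\<And>i. i \<in> I \<Longrightarrow> L i w = 0) \<Longrightarrow> w = 0"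
  shows "\<exists>F. finite F \<and> S \<subseteq> span F"
  using assms
proof (induction I arbitrary: S rule: finite_induct)
  case empty
  then have "S \<subseteq> span {}" by auto
  then show ?case by blast
next
  case (insert i I)
  let ?K = "{w \<in> S. L i w = 0}"
  have lin: "linear (L i)" using insert.prems by simp
  have "subspace ?K"
    using insert.prems(1) lin unfolding subspace_def
    by (auto simp: linear_0 linear_add linear_scale)
  then have "\<exists>F. finite F \<and> ?K \<subseteq> span F"
    using insert.prems by (intro insert.IH) auto
  then obtain F where F: "finite F" "?K \<subseteq> span F" by blast
  show ?case
  proof (cases "S = ?K")
    case True
    then show ?thesis using F by auto
  next
    case False
    then obtain w0 where w0: "w0 \<in> S" "L i w0 \<noteq> 0" by auto
    have "w \<in> span (insert w0 F)" if "w \<in> S" for w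
    proof -
      have "w - (L i w / L i w0) *\<^sub>R w0 \<in> ?K"
        using that w0 insert.prems(1) lin
        by (auto simp: subspace_diff subspace_scale linear_diff linear_scale)
      then show ?thesis using F span_breakdown_eq by blast
    qed
    then show ?thesis using F by (intro exI[of _ "insert w0 F"]) auto
  qed
qed

instance real :: finite_dim_space
proof (standard, rule finite_dim_spaceI)
  have "x \<in> span {1}" for x :: real
    using span_scale[OF span_base[of "1::real" "{1}"], of x] by simp
  then show "\<exists>B::real set. finite B \<and> span B = UNIV"
    by (intro exI[of _ "{1}"]) auto
qed

instance prod :: (finite_dim_space, finite_dim_space) finite_dim_space
proof (standard, rule finite_dim_spaceI)
  obtain B :: "'a set" where B: "finite B" "span B = UNIV" using finite_spanning_set by blast
  obtain C :: "'b set" where C: "finite C" "span C = UNIV" using finite_spanning_set by blast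
  let ?D = "(\<lambda>x. (x, 0)) ` B \<union> (\<lambda>y. (0, y)) ` C"
  have l1: "linear (\<lambda>x::'a. (x, 0::'b))" and l2: "linear (\<lambda>y::'b. (0::'a, y))"
    by (auto intro!: linearI)
  have "(x, y) \<in> span ?D" for x :: 'a and y :: 'b
  proof -
    have "(x, 0) \<in> span ((\<lambda>x. (x, 0::'b)) ` B)" "(0, y) \<in> span ((\<lambda>y. (0::'a, y)) ` C)"
      using B C by (auto simp: span_linear_image[OF l1] span_linear_image[OF l2])
    then have "(x, 0) + (0, y) \<in> span ?D"
      by (intro span_add) (auto intro: span_mono[THEN subsetD, rotated])
    then show ?thesis by simp
  qed
  then show "\<exists>D::('a \<times> 'b) set. finite D \<and> span D = UNIV"
    using B C by (intro exI[of _ ?D]) auto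
qed

instance blinfun :: (finite_dim_space, finite_dim_space) finite_dim_space
proof (standard, rule finite_dim_spaceI)
  obtain B :: "'a set" where B: "finite B" "span B = UNIV" using finite_spanning_set by blast
  obtain C' :: "'b set" where C': "finite C'" "span C' = UNIV" using finite_spanning_set by blast
  obtain C where C: "C \<subseteq> C'" "independent C" "C' \<subseteq> span C"
    using maximal_independent_subset[of C'] by blast
  have spC: "span C = UNIV" using C(3) C'(2) span_mono span_span by blast
  have finC: "finite C" using C C' finite_subset by blast
  define L where "L = (\<lambda>(b, c) (f :: 'a \<Rightarrow>\<^sub>L 'b). representation C (blinfun_apply f b) c)"
  have "\<exists>F. finite F \<and> (UNIV :: ('a \<Rightarrow>\<^sub>L 'b) set) \<subseteq> span F"
  proof (rule finite_span_of_separating_functionals[of "B \<times> C" UNIV L])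
    show "finite (B \<times> C)" using B finC by simp
    show "subspace (UNIV :: ('a \<Rightarrow>\<^sub>L 'b) set)" by simp
    show "linear (L i)" for i
      by (cases i) (auto intro!: linearI simp: L_def blinfun.bilinear_simps
          representation_add[OF C(2)] representation_scale[OF C(2)] spC)
    fix f :: "'a \<Rightarrow>\<^sub>L 'b" assume 0: "\<And>i. i \<in> B \<times> C \<Longrightarrow> L i f = 0"
    have "blinfun_apply f b = 0" if "b \<in> B" for b
    proof -
      have "(\<Sum>c\<in>C. representation C (blinfun_apply f b) c *\<^sub>R c) = blinfun_apply f b"
        by (rule sum_representation_eq) (use C finC spC in auto)
      moreover have "representation C (blinfun_apply f b) c = 0" if "c \<in> C" for c
        using 0[of "(b, c)"] that \<open>b \<in> B\<close> by (simp add: L_def)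
      ultimately show ?thesis by simp
    qed
    then have "blinfun_apply f x = 0" for x
      using linear_eq_0_on_span[of "blinfun_apply f" B x] B
      by (simp add: blinfun.bounded_linear_right bounded_linear.linear)
    then show "f = 0" by (intro blinfun_eqI) simp
  qed
  then show "\<exists>F::('a \<Rightarrow>\<^sub>L 'b) set. finite F \<and> span F = UNIV" by blast
qed

type_synonym 'a dual = "'a \<Rightarrow>\<^sub>L real"

definition unshuffles :: "nat \<Rightarrow> nat \<Rightarrow> (nat \<Rightarrow> nat) set" where
  "unshuffles p q = {\<sigma>. \<sigma> permutes {..<p + q} \<and>
      strict_mono_on {..<p} \<sigma> \<and> strict_mono_on {p..<p + q} \<sigma>}"


section \<open>2-term L-infinity algebras\<close>

text \<open>The bracket of an element of degree -1 with one of degree 0: $l_2(m,x) = -l_2(x,m)$.\<close>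

definition swap_bracket :: "('x \<Rightarrow> 'm \<Rightarrow> 'm) \<Rightarrow> 'm \<Rightarrow> 'x \<Rightarrow> 'm::real_vector" where
  "swap_bracket l21 m x = - l21 x m"

locale two_term_Linfty =
  fixes l1 :: "'m::finite_dim_space \<Rightarrow> 'x::finite_dim_space"
    and l20 :: "'x \<Rightarrow> 'x \<Rightarrow> 'x"
    and l21 :: "'x \<Rightarrow> 'm \<Rightarrow> 'm"
    and l3 :: "'x \<Rightarrow> 'x \<Rightarrow> 'x \<Rightarrow> 'm"
  assumes linear_l1: "linear l1"
    and bilinear_l20: "bilinear l20"
    and alternating_l20: "l20 x x = 0"
    and bilinear_l21: "bilinear l21"
    and linear_l3: "linear (\<lambda>x. l3 x y z)" "linear (\<lambda>y. l3 x y z)" "linear (\<lambda>z. l3 x y z)"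
    and alternating_l3: "l3 x x y = 0" "l3 x y x = 0" "l3 y x x = 0"
    and l1_l21: "l1 (l21 x m) = l20 x (l1 m)"
    and l21_l1: "l21 (l1 m) n = swap_bracket l21 m (l1 n)"
    and Jacobi_0: "l20 (l20 x y) z + l20 (l20 y z) x + l20 (l20 z x) y + l1 (l3 x y z) = 0"
    and Jacobi_1: "l21 (l20 x y) m + swap_bracket l21 (l21 y m) x
        + swap_bracket l21 (swap_bracket l21 m x) y + l3 x y (l1 m) = 0"
    and coherence: "(\<Sum>\<sigma>\<in>unshuffles 2 2. of_int (sign \<sigma>) *\<^sub>R
          l3 (l20 (xs (\<sigma> 0)) (xs (\<sigma> 1))) (xs (\<sigma> 2)) (xs (\<sigma> 3))) =
        (\<Sum>\<tau>\<in>unshuffles 3 1. of_int (sign \<tau>) *\<^sub>R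
          swap_bracket l21 (l3 (xs (\<tau> 0)) (xs (\<tau> 1)) (xs (\<tau> 2))) (xs (\<tau> 3)))"


section \<open>Multivector fields on vector spaces\<close>

text \<open>
  $\wedge^k F$ is identified with the alternating $k$-linear forms on $F^*$ via
  $(e_1\wedge\dots\wedge e_k)(\alpha_1,\dots,\alpha_k) = \det(\alpha_i(e_j))$. Such a form takes a list
  of covectors, and is 0 on lists of length different from $k$, so that equality of $k$-vectors
  is equality of functions.
\<close>

definition multivector :: "nat \<Rightarrow> ('f::finite_dim_space dual list \<Rightarrow> real) \<Rightarrow> bool" where
  "multivector k P \<longleftrightarrow>
    (\<forall>\<alpha>s. length \<alpha>s \<noteq> k \<longrightarrow> P \<alpha>s = 0) \<and>
    (\<forall>\<alpha>s i. length \<alpha>s = k \<and> i < k \<longrightarrow> linear (\<lambda>\<alpha>. P (\<alpha>s[i := \<alpha>]))) \<and>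
    (\<forall>\<alpha>s i j. length \<alpha>s = k \<and> i < j \<and> j < k \<and> \<alpha>s ! i = \<alpha>s ! j \<longrightarrow> P \<alpha>s = 0)"

definition pushforward :: "('e::finite_dim_space \<Rightarrow> 'f::finite_dim_space) \<Rightarrow>
    ('e dual list \<Rightarrow> real) \<Rightarrow> 'f dual list \<Rightarrow> real" where
  "pushforward L P \<alpha>s = P (map (\<lambda>\<alpha>. \<alpha> o\<^sub>L Blinfun L) \<alpha>s)"

text \<open>On a finite-dimensional space this is $C^\infty$: all iterated directional derivatives exist
  and are (totally) differentiable, hence continuous.\<close>

coinductive smooth :: "('e::finite_dim_space \<Rightarrow> real) \<Rightarrow> bool" where
  "\<lbrakk>\<And>x. f differentiable (at x); \<And>v. smooth (\<lambda>x. frechet_derivative f (at x) v)\<rbrakk> \<Longrightarrow> smooth f"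

definition differential :: "('e::finite_dim_space \<Rightarrow> real) \<Rightarrow> 'e \<Rightarrow> 'e dual" where
  "differential f x = Blinfun (frechet_derivative f (at x))"

text \<open>Smooth sections of the trivial bundle $B \times \wedge^k F \to B$; the $k$-vector fields on
  $E$ are the case $B = F = E$.\<close>

definition multivector_section ::
    "nat \<Rightarrow> ('b::finite_dim_space \<Rightarrow> 'f::finite_dim_space dual list \<Rightarrow> real) \<Rightarrow> bool" where
  "multivector_section k P \<longleftrightarrow> (\<forall>b. multivector k (P b)) \<and> (\<forall>\<alpha>s. smooth (\<lambda>b. P b \<alpha>s))"

abbreviation multivector_field ::
    "nat \<Rightarrow> ('e::finite_dim_space \<Rightarrow> 'e dual list \<Rightarrow> real) \<Rightarrow> bool" where
  "multivector_field k P \<equiv> multivector_section k P"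

text \<open>
  Schouten bracket of a $p$-vector field $P$ and a $q$-vector field $Q$ ($p, q \ge 1$), evaluated on
  constant covectors. The sum
  \[ (P \circ Q)(f_1,\dots,f_{p+q-1}) = \sum_{\sigma} \mathrm{sgn}(\sigma)\,
     P(Q(f_{\sigma(1)},\dots,f_{\sigma(q)}), f_{\sigma(q+1)},\dots,f_{\sigma(p+q-1)}) \]
  over $(q,p-1)$-unshuffles is the composition of $P$ and $Q$ as multiderivations of functions, and
  $[P,Q] = (-1)^{(p-1)(q-1)} P \circ Q - Q \circ P$. The sign convention is the one for which
  \[ [X_1\wedge\dots\wedge X_p, Y_1\wedge\dots\wedge Y_q] = \sum_{i,j} (-1)^{i+j} [X_i,Y_j]\wedge
     X_1\wedge\dots\widehat{X_i}\dots\wedge X_p\wedge Y_1\wedge\dots\widehat{Y_j}\dots\wedge Y_q; \]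
  in particular $\frac12[\Pi,\Pi](df,dg,dh) = -(\{\{f,g\},h\} + c.p.)$ for a bivector field.
\<close>

definition multiderivation_comp :: "nat \<Rightarrow> nat \<Rightarrow> ('e::finite_dim_space \<Rightarrow> 'e dual list \<Rightarrow> real) \<Rightarrow>
    ('e \<Rightarrow> 'e dual list \<Rightarrow> real) \<Rightarrow> 'e \<Rightarrow> 'e dual list \<Rightarrow> real" where
  "multiderivation_comp p q P Q x \<alpha>s =
    (\<Sum>\<sigma>\<in>unshuffles q (p - 1). of_int (sign \<sigma>) *
      P x (differential (\<lambda>y. Q y (map (\<lambda>i. \<alpha>s ! \<sigma> i) [0..<q])) x #
           map (\<lambda>i. \<alpha>s ! \<sigma> i) [q..<p + q - 1]))"

definition schouten :: "nat \<Rightarrow> nat \<Rightarrow> ('e::finite_dim_space \<Rightarrow> 'e dual list \<Rightarrow> real) \<Rightarrow>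
    ('e \<Rightarrow> 'e dual list \<Rightarrow> real) \<Rightarrow> 'e \<Rightarrow> 'e dual list \<Rightarrow> real" where
  "schouten p q P Q x \<alpha>s = (if length \<alpha>s = p + q - 1 then
      (-1) ^ ((p - 1) * (q - 1)) * multiderivation_comp p q P Q x \<alpha>s
      - multiderivation_comp q p Q P x \<alpha>s else 0)"

text \<open>Velocities of curves in $S$; this is $T_pS$ when $S$ is an embedded submanifold.\<close>

definition tangent_vectors :: "'e::real_normed_vector set \<Rightarrow> 'e \<Rightarrow> 'e set" where
  "tangent_vectors S p = {v. \<exists>c :: real \<Rightarrow> 'e.
      (\<forall>t. c t \<in> S) \<and> c 0 = p \<and> (c has_vector_derivative v) (at 0)}"

definition coisotropic :: "('e::finite_dim_space \<Rightarrow> 'e dual list \<Rightarrow> real) \<Rightarrow> 'e set \<Rightarrow> bool" where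
  "coisotropic W S \<longleftrightarrow> (\<forall>p\<in>S. \<forall>\<alpha> \<beta>.
      (\<forall>v\<in>tangent_vectors S p. blinfun_apply \<alpha> v = 0) \<and>
      (\<forall>v\<in>tangent_vectors S p. blinfun_apply \<beta> v = 0) \<longrightarrow> W p [\<alpha>, \<beta>] = 0)"


section \<open>2-vector spaces\<close>

text \<open>A category internal to vector spaces with source \<open>s\<close>, target \<open>t\<close>, identities \<open>u\<close> and
  composition \<open>c g h\<close>, which is only meaningful for \<open>t g = s h\<close>.\<close>

locale two_vector_space =
  fixes s t :: "'g::finite_dim_space \<Rightarrow> 'o::finite_dim_space"
    and u :: "'o \<Rightarrow> 'g"
    and c :: "'g \<Rightarrow> 'g \<Rightarrow> 'g"
  assumes linear_s: "linear s" and linear_t: "linear t" and linear_u: "linear u"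
    and c_add: "t g = s h \<Longrightarrow> t g' = s h' \<Longrightarrow> c (g + g') (h + h') = c g h + c g' h'"
    and c_scale: "t g = s h \<Longrightarrow> c (r *\<^sub>R g) (r *\<^sub>R h) = r *\<^sub>R c g h"
    and s_u: "s (u v) = v" and t_u: "t (u v) = v"
    and s_c: "t g = s h \<Longrightarrow> s (c g h) = s g" and t_c: "t g = s h \<Longrightarrow> t (c g h) = t h"
    and u_left: "c (u (s g)) g = g" and u_right: "c g (u (t g)) = g"
    and c_assoc: "t g = s h \<Longrightarrow> t h = s k \<Longrightarrow> c (c g h) k = c g (c h k)"

text \<open>The 2-vector space of a 2-term complex \<open>d\<close> from \<open>'v1\<close> to \<open>'v0\<close>, with arrows \<open>'v0 \<times> 'v1\<close>.\<close>

definition src :: "'v0 \<times> 'v1 \<Rightarrow> 'v0" where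
  "src g = fst g"

definition tgt :: "('v1 \<Rightarrow> 'v0) \<Rightarrow> 'v0 \<times> 'v1 \<Rightarrow> 'v0::plus" where
  "tgt d g = fst g + d (snd g)"

definition unit_arrow :: "'v0 \<Rightarrow> 'v0 \<times> 'v1::zero" where
  "unit_arrow v = (v, 0)"

definition arrow_comp :: "'v0 \<times> 'v1 \<Rightarrow> 'v0 \<times> 'v1 \<Rightarrow> 'v0 \<times> 'v1::plus" where
  "arrow_comp g h = (fst g, snd g + snd h)"

definition inv_arrow :: "('v1 \<Rightarrow> 'v0) \<Rightarrow> 'v0 \<times> 'v1 \<Rightarrow> 'v0::plus \<times> 'v1::uminus" where
  "inv_arrow d g = (fst g + d (snd g), - snd g)"

text \<open>Everything being linear, such a 2-vector space is a Lie groupoid as soon as \<open>inv_arrow\<close>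
  provides inverses.\<close>

definition two_vector_groupoid :: "('v1::finite_dim_space \<Rightarrow> 'v0::finite_dim_space) \<Rightarrow> bool" where
  "two_vector_groupoid d \<longleftrightarrow> linear d \<and>
    two_vector_space src (tgt d) (unit_arrow :: 'v0 \<Rightarrow> 'v0 \<times> 'v1) arrow_comp \<and>
    (\<forall>g. src (inv_arrow d g) = tgt d g \<and> tgt d (inv_arrow d g) = src g \<and>
      arrow_comp g (inv_arrow d g) = unit_arrow (src g) \<and>
      arrow_comp (inv_arrow d g) g = unit_arrow (tgt d g))"

text \<open>Multiplicativity of a bivector field: the graph of the multiplication is coisotropic in
  $\Gamma\times\Gamma\times\Gamma$ with respect to $\Pi\oplus\Pi\oplus(-\Pi)$.\<close>

definition mult_graph :: "('v1 \<Rightarrow> 'v0) \<Rightarrow>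
    (('v0::plus \<times> 'v1::plus) \<times> ('v0 \<times> 'v1) \<times> ('v0 \<times> 'v1)) set" where
  "mult_graph d = {(g, h, arrow_comp g h) | g h. tgt d g = src h}"

definition triple_bivector :: "('g::finite_dim_space \<Rightarrow> 'g dual list \<Rightarrow> real) \<Rightarrow>
    'g \<times> 'g \<times> 'g \<Rightarrow> ('g \<times> 'g \<times> 'g) dual list \<Rightarrow> real" where
  "triple_bivector P = (\<lambda>(g, h, k) \<alpha>s.
      pushforward (\<lambda>a. (a, 0, 0)) (P g) \<alpha>s + pushforward (\<lambda>a. (0, a, 0)) (P h) \<alpha>s
      - pushforward (\<lambda>a. (0, 0, a)) (P k) \<alpha>s)"

definition multiplicative_bivector :: "('v1::finite_dim_space \<Rightarrow> 'v0::finite_dim_space) \<Rightarrow>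
    ('v0 \<times> 'v1 \<Rightarrow> ('v0 \<times> 'v1) dual list \<Rightarrow> real) \<Rightarrow> bool" where
  "multiplicative_bivector d P \<longleftrightarrow> coisotropic (triple_bivector P) (mult_graph d)"

text \<open>Translations of sections of $\wedge^kA$, where $A = V_0 \times V_1 \to V_0$: the multiplicative
  extension of $e \mapsto (0, e)$ at the target and of $e \mapsto (-\mathrm{d}e, e)$ at the source.\<close>

definition left_translation :: "('v1::finite_dim_space \<Rightarrow> 'v0::finite_dim_space) \<Rightarrow>
    ('v0 \<Rightarrow> 'v1 dual list \<Rightarrow> real) \<Rightarrow> 'v0 \<times> 'v1 \<Rightarrow> ('v0 \<times> 'v1) dual list \<Rightarrow> real" where
  "left_translation d \<phi> g = pushforward (\<lambda>e. (0, e)) (\<phi> (tgt d g))"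

definition right_translation :: "('v1::finite_dim_space \<Rightarrow> 'v0::finite_dim_space) \<Rightarrow>
    ('v0 \<Rightarrow> 'v1 dual list \<Rightarrow> real) \<Rightarrow> 'v0 \<times> 'v1 \<Rightarrow> ('v0 \<times> 'v1) dual list \<Rightarrow> real" where
  "right_translation d \<phi> g = pushforward (\<lambda>e. (- d e, e)) (\<phi> (src g))"


section \<open>Lie-quasi-Poisson groupoids\<close>

definition quasi_Poisson_groupoid :: "('v1::finite_dim_space \<Rightarrow> 'v0::finite_dim_space) \<Rightarrow>
    ('v0 \<times> 'v1 \<Rightarrow> ('v0 \<times> 'v1) dual list \<Rightarrow> real) \<Rightarrow> ('v0 \<Rightarrow> 'v1 dual list \<Rightarrow> real) \<Rightarrow> bool" where
  "quasi_Poisson_groupoid d P \<phi> \<longleftrightarrow>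
    two_vector_groupoid d \<and>
    multivector_field 2 P \<and> multiplicative_bivector d P \<and>
    multivector_section 3 \<phi> \<and>
    (\<forall>g \<alpha>s. 1 / 2 * schouten 2 2 P P g \<alpha>s = left_translation d \<phi> g \<alpha>s - right_translation d \<phi> g \<alpha>s) \<and>
    (\<forall>g \<alpha>s. schouten 2 3 P (left_translation d \<phi>) g \<alpha>s = 0)"

definition Lie_quasi_Poisson_groupoid :: "('v1::finite_dim_space \<Rightarrow> 'v0::finite_dim_space) \<Rightarrow>
    ('v0 \<times> 'v1 \<Rightarrow> ('v0 \<times> 'v1) dual list \<Rightarrow> real) \<Rightarrow> ('v0 \<Rightarrow> 'v1 dual list \<Rightarrow> real) \<Rightarrow> bool" where
  "Lie_quasi_Poisson_groupoid d P \<phi> \<longleftrightarrow>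
    quasi_Poisson_groupoid d P \<phi> \<and>
    (\<forall>\<alpha>s. linear (\<lambda>g. P g \<alpha>s)) \<and> (\<forall>\<alpha>s. linear (\<lambda>v. \<phi> v \<alpha>s))"


section \<open>The dual of a 2-term L-infinity algebra\<close>

text \<open>The dual map carries a minus sign: $\langle l_1^*\xi, m\rangle = -\langle\xi, l_1(m)\rangle$.\<close>

definition dual_map :: "('m::finite_dim_space \<Rightarrow> 'x::finite_dim_space) \<Rightarrow> 'x dual \<Rightarrow> 'm dual" where
  "dual_map l1 \<xi> = Blinfun (\<lambda>m. - blinfun_apply \<xi> (l1 m))"

text \<open>Elements of degree 0 and -1 as linear functions on $\mathfrak{g}_{-1}^* \oplus \mathfrak{g}_0^*$.\<close>

definition fun0 :: "'x \<Rightarrow> 'm::finite_dim_space dual \<times> 'x::finite_dim_space dual \<Rightarrow> real" where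
  "fun0 x z = blinfun_apply (snd z) x"

definition fun1 :: "'m \<Rightarrow> 'm::finite_dim_space dual \<times> 'x::finite_dim_space dual \<Rightarrow> real" where
  "fun1 m z = blinfun_apply (fst z) m"

definition dual_bivector_field :: "('m::finite_dim_space \<Rightarrow> 'x::finite_dim_space) \<Rightarrow>
    ('x \<Rightarrow> 'x \<Rightarrow> 'x) \<Rightarrow> ('x \<Rightarrow> 'm \<Rightarrow> 'm) \<Rightarrow>
    ('m dual \<times> 'x dual \<Rightarrow> ('m dual \<times> 'x dual) dual list \<Rightarrow> real) \<Rightarrow> bool" where
  "dual_bivector_field l1 l20 l21 P \<longleftrightarrow> multivector_field 2 P \<and>
    (\<forall>z x y. P z [differential (fun0 x) z, differential (fun0 y) z] = - fun0 (l20 x y) z) \<and>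
    (\<forall>z x m. P z [differential (fun0 x) z, differential (fun1 m) z] = - fun1 (l21 x m) z) \<and>
    (\<forall>z m n. P z [differential (fun1 m) z, differential (fun1 n) z] = - fun1 (l21 (l1 m) n) z)"

definition eval_at :: "'x::finite_dim_space \<Rightarrow> 'x dual dual" where
  "eval_at x = Blinfun (\<lambda>\<xi>. blinfun_apply \<xi> x)"

text \<open>The trisection $-l_3$: a linear map from $\mathfrak{g}_{-1}^*$ to $\wedge^3\mathfrak{g}_0^*$. As
  3-vectors in $\mathfrak{g}_0^*$ are encoded by forms on its dual $\mathfrak{g}_0^{**}$, the elements
  of $\mathfrak{g}_0$ enter through the canonical isomorphism \<^const>\<open>eval_at\<close>.\<close>

definition minus_l3_section :: "('x \<Rightarrow> 'x \<Rightarrow> 'x \<Rightarrow> 'm) \<Rightarrow>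
    'm::finite_dim_space dual \<Rightarrow> 'x::finite_dim_space dual dual list \<Rightarrow> real" where
  "minus_l3_section l3 \<eta> as = (if length as = 3 then
      - blinfun_apply \<eta> (l3 (inv eval_at (as ! 0)) (inv eval_at (as ! 1)) (inv eval_at (as ! 2)))
    else 0)"

end

theory Submission
  imports Defs
begin

text \<open>
  Linear functions on $\mathfrak{g}_{-1}^* \oplus \mathfrak{g}_0^*$ are elements of
  $\mathfrak{g}_{-1} \oplus \mathfrak{g}_0$, and on them $\Pi$ is minus the bracket
  $[(m, x), (n, y)] = (l_2(x, n) - l_2(y, m) + l_2(l_1 m, n),\; l_2(x, y))$. The Jacobiator of this
  bracket at $(m, x), (n, y), (p, z)$ is
  $(l_3(x, y, z) - l_3(x + l_1 m, y + l_1 n, z + l_1 p),\; -l_1 l_3(x, y, z))$; the left and right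
  translations of $-l_3$ differ by exactly this, because a linear function $(m, x)$ restricts to
  $x$ along left and to $x + l_1 m$ along right translations. In the same way $[\Pi,
  \overleftarrow{\phi}] = 0$ is, term by term over unshuffles, the coherence law for $l_3$ paired
  with the target of the arrow. Multiplicativity is a computation on the conormal space of the graph
  of the multiplication, which consists of the triples
  $(k - m, x + l_1 m), (m, x), (-k, -x)$.
\<close>

section \<open>Finite-dimensional normed spaces\<close>

text \<open>Bounded coordinates turn a convergent sequence in the span into Cauchy, hence
  convergent, coordinate sequences. Summing their limits against the basis gives the limit vector,
  which thus lies in the span.\<close>

lemma closed_span_if_coordinates_bounded:
  fixes B :: "'a::real_normed_vector set"
  assumes fin: "finite B" and ind: "independent B"
    and C: "\<And>v b. v \<in> span B \<Longrightarrow> b \<in> B \<Longrightarrow> \<bar>representation B v b\<bar> \<le> C * norm v"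
  shows "closed (span B)"
  unfolding closed_sequential_limits
proof (intro allI impI, elim conjE)
  fix v l assume v: "\<forall>n. v n \<in> span B" and l: "v \<longlonglongrightarrow> l"
  have "convergent (\<lambda>n. representation B (v n) b)" if b: "b \<in> B" for b
  proof -
    have "Cauchy (\<lambda>n. representation B (v n) b)"
    proof (rule metric_CauchyI)
      fix e :: real assume e: "0 < e"
      \<comment> \<open>\<open>C\<close> may be zero or negative, so the divisor is
        \<open>\<bar>C\<bar> + 1\<close>.\<close>
      have pos: "0 < e / (\<bar>C\<bar> + 1)" using e by simp
      obtain N where N: "\<And>m n. m \<ge> N \<Longrightarrow> n \<ge> N \<Longrightarrow> dist (v m) (v n) < e / (\<bar>C\<bar> + 1)"
        using metric_CauchyD[OF LIMSEQ_imp_Cauchy[OF l] pos] by blast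
      have "dist (representation B (v m) b) (representation B (v n) b) < e"
        if "m \<ge> N" "n \<ge> N" for m n
      proof -
        have "dist (representation B (v m) b) (representation B (v n) b)
            = \<bar>representation B (v m - v n) b\<bar>"
          using v by (simp add: dist_real_def representation_diff[OF ind])
        also have "\<dots> \<le> C * norm (v m - v n)"
          using C b v by (simp add: span_diff)
        also have "\<dots> \<le> (\<bar>C\<bar> + 1) * norm (v m - v n)"
          by (intro mult_right_mono) auto
        also have "\<dots> < e"
          using N[OF that] by (simp add: dist_norm pos_less_divide_eq mult.commute)
        finally show ?thesis .
      qed
      then show "\<exists>N. \<forall>m\<ge>N. \<forall>n\<ge>N. dist (representation B (v m) b) (representation B (v n) b) < e"
        by blast
    qed
    then show ?thesis by (simp add: Cauchy_convergent_iff)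
  qed
  then have "(\<lambda>n. \<Sum>b\<in>B. representation B (v n) b *\<^sub>R b) \<longlonglongrightarrow>
      (\<Sum>b\<in>B. lim (\<lambda>n. representation B (v n) b) *\<^sub>R b)"
    by (intro tendsto_sum tendsto_scaleR tendsto_const) (simp add: convergent_LIMSEQ_iff)
  moreover have "(\<Sum>b\<in>B. representation B (v n) b *\<^sub>R b) = v n" for n
    using v by (intro sum_representation_eq ind fin) auto
  ultimately have "l = (\<Sum>b\<in>B. lim (\<lambda>n. representation B (v n) b) *\<^sub>R b)"
    using l LIMSEQ_unique by simp
  then show "l \<in> span B"
    by (auto intro!: span_sum span_scale intro: span_base)
qed

text \<open>The induction needs the span of the smaller set to be closed, so that the new basis vector has
  positive distance from it.\<close>

lemma coordinates_bounded:
  fixes B :: "'a::real_normed_vector set"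
  assumes "finite B" "independent B"
  shows "\<exists>C. \<forall>v\<in>span B. \<forall>b\<in>B. \<bar>representation B v b\<bar> \<le> C * norm v"
  using assms
proof (induction B rule: finite_induct)
  case empty
  then show ?case by simp
next
  case (insert w B)
  have indB: "independent B" using insert.prems independent_mono by blast
  have ind: "independent (insert w B)" by (rule insert.prems)
  have w: "w \<notin> span B"
    using insert.prems insert.hyps independent_insert by metis
  obtain C where C: "\<And>v b. v \<in> span B \<Longrightarrow> b \<in> B \<Longrightarrow> \<bar>representation B v b\<bar> \<le> C * norm v"
    using insert.IH[OF indB] by blast
  have "closed (span B)"
    using closed_span_if_coordinates_bounded[OF insert.hyps(1) indB C] .
  then have "open (- span B)" by (rule open_Compl)
  then obtain \<delta> where \<delta>: "\<delta> > 0" "\<And>v. v \<in> span B \<Longrightarrow> \<delta> \<le> norm (w - v)"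
    using w unfolding open_dist
    by (metis ComplD ComplI dist_commute dist_norm linorder_not_le)
  \<comment> \<open>Homogeneity: dividing by \<open>r\<close> reduces the estimate to the distance
    \<delta> of \<open>w\<close> from \<open>span B\<close>.\<close>
  have scal: "\<bar>r\<bar> * \<delta> \<le> norm (r *\<^sub>R w + u)" if u: "u \<in> span B" for r u
  proof (cases "r = 0")
    case False
    have "r *\<^sub>R w + u = r *\<^sub>R (w - (- inverse r) *\<^sub>R u)"
      using False by (simp add: algebra_simps)
    then have "norm (r *\<^sub>R w + u) = \<bar>r\<bar> * norm (w - (- inverse r) *\<^sub>R u)"
      by (metis norm_scaleR)
    moreover have "\<delta> \<le> norm (w - (- inverse r) *\<^sub>R u)"
      by (intro \<delta> span_scale u)
    ultimately show ?thesis by (simp add: mult_left_mono)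
  qed simp
  \<comment> \<open>The first summand bounds the coordinate at \<open>w\<close>. The second bounds
    the others, by applying \<open>C\<close> to what remains after removing the multiple of
    \<open>w\<close>. Both are nonnegative, so either may be dropped.\<close>
  let ?D = "1 / \<delta> + \<bar>C\<bar> * (1 + norm w / \<delta>)"
  have "\<bar>representation (insert w B) v b\<bar> \<le> ?D * norm v"
    if v: "v \<in> span (insert w B)" and b: "b \<in> insert w B" for v b
  proof -
    define r where "r = representation (insert w B) v w"
    define u where "u = v - r *\<^sub>R w"
    have usum: "u = (\<Sum>b\<in>B. representation (insert w B) v b *\<^sub>R b)"
      using sum_representation_eq[OF ind v, of "insert w B"] insert.hyps
      by (simp add: u_def r_def algebra_simps)
    then have u: "u \<in> span B"
      by (auto intro!: span_sum span_scale intro: span_base)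
    have rep: "representation (insert w B) v b = representation B u b" if "b \<in> B"
    proof -
      have "representation (insert w B) v b
          = representation (insert w B) (r *\<^sub>R w) b + representation (insert w B) u b"
        using representation_add[OF ind, of "r *\<^sub>R w" u] u
        by (simp add: u_def span_base span_scale span_mono[THEN subsetD, OF subset_insertI])
      also have "representation (insert w B) (r *\<^sub>R w) b = 0"
        using that insert.hyps
        by (auto simp: representation_scale[OF ind] representation_basis[OF ind] span_base)
      also have "representation (insert w B) u b = representation B u b"
        using representation_extend[OF ind u subset_insertI] by (rule fun_cong)
      finally show ?thesis by simp
    qed
    have r: "\<bar>r\<bar> \<le> norm v / \<delta>"
      using scal[OF u, of r] \<delta>(1) by (simp add: u_def pos_le_divide_eq)
    have "norm u \<le> norm v + \<bar>r\<bar> * norm w"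
      unfolding u_def by (metis norm_scaleR norm_triangle_ineq4)
    also have "\<dots> \<le> norm v + norm v / \<delta> * norm w"
      using r by (intro add_left_mono mult_right_mono) auto
    finally have nu: "norm u \<le> (1 + norm w / \<delta>) * norm v"
      by (simp add: algebra_simps)
    have nn: "0 \<le> \<bar>C\<bar> * (1 + norm w / \<delta>) * norm v" "0 \<le> norm v / \<delta>"
      using \<delta>(1) by auto
    show ?thesis
    proof (cases "b = w")
      case True
      then show ?thesis using r nn by (simp add: r_def distrib_right)
    next
      case False
      then have "\<bar>representation (insert w B) v b\<bar> \<le> C * norm u"
        using C[OF u, of b] b rep by auto
      also have "\<dots> \<le> \<bar>C\<bar> * norm u" by (intro mult_right_mono) auto
      also have "\<dots> \<le> \<bar>C\<bar> * ((1 + norm w / \<delta>) * norm v)"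
        by (intro mult_left_mono nu) auto
      finally show ?thesis using nn by (simp add: distrib_right mult.assoc)
    qed
  qed
  then show ?case by blast
qed

lemma finite_basis_exists: "\<exists>B. finite B \<and> independent B \<and> span B = (UNIV :: 'a::finite_dim_space set)"
proof -
  obtain C :: "'a set" where C: "finite C" "span C = UNIV" using finite_spanning_set by blast
  obtain B where B: "B \<subseteq> C" "independent B" "C \<subseteq> span B"
    using maximal_independent_subset[of C] by blast
  then show ?thesis using C finite_subset span_mono span_span by (metis top.extremum_uniqueI)
qed

text \<open>Expanding in a basis, bounded coordinates leave a finite sum of multiples of
  \<open>norm v\<close>.\<close>

lemma linear_imp_bounded_linear:
  fixes f :: "'a::finite_dim_space \<Rightarrow> 'b::real_normed_vector"
  assumes "linear f"
  shows "bounded_linear f"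
proof -
  obtain B :: "'a set" where B: "finite B" "independent B" "span B = UNIV"
    using finite_basis_exists by blast
  obtain C where C: "\<And>v b. b \<in> B \<Longrightarrow> \<bar>representation B v b\<bar> \<le> C * norm v"
    using coordinates_bounded[OF B(1,2)] B(3) by auto
  have "norm (f v) \<le> norm v * (\<Sum>b\<in>B. C * norm (f b))" for v
  proof -
    have "f v = f (\<Sum>b\<in>B. representation B v b *\<^sub>R b)"
      using sum_representation_eq[OF B(2), of v B] B by simp
    also have "norm \<dots> \<le> (\<Sum>b\<in>B. \<bar>representation B v b\<bar> * norm (f b))"
      by (simp add: linear_sum[OF assms] linear_scale[OF assms] sum_norm_le)
    also have "\<dots> \<le> (\<Sum>b\<in>B. C * norm v * norm (f b))"
      by (intro sum_mono mult_right_mono C) auto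
    finally show ?thesis by (simp add: sum_distrib_left mult_ac)
  qed
  then show ?thesis
    using assms by (auto simp: bounded_linear_def bounded_linear_axioms_def)
qed

section \<open>Linear maps as bounded maps, and the bidual\<close>

lemma blinfun_apply_Blinfun [simp]:
  fixes f :: "'a::finite_dim_space \<Rightarrow> 'b::real_normed_vector"
  shows "linear f \<Longrightarrow> blinfun_apply (Blinfun f) = f"
  by (simp add: bounded_linear_Blinfun_apply linear_imp_bounded_linear)

lemma linear_blinfun_apply: "linear (blinfun_apply f)"
  by (simp add: blinfun.bounded_linear_right bounded_linear.linear)

lemma eval_at_apply [simp]: "blinfun_apply (eval_at x) \<xi> = blinfun_apply \<xi> x"
  unfolding eval_at_def
  by (subst blinfun_apply_Blinfun) (auto intro!: linearI simp: blinfun.bilinear_simps)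

lemma linear_eval_at: "linear eval_at"
  by (auto intro!: linearI blinfun_eqI simp: blinfun.bilinear_simps)

text \<open>Reflexivity by a dual basis: the coordinate functionals \<open>c b\<close> separate
  points, and \<alpha> is evaluation at the vector with coordinates
  \<open>blinfun_apply \<alpha> (c b)\<close>.\<close>

lemma bij_eval_at: "bij (eval_at :: 'a::finite_dim_space \<Rightarrow> _)"
proof -
  obtain B :: "'a set" where B: "finite B" "independent B" "span B = UNIV"
    using finite_basis_exists by blast
  define c where "c = (\<lambda>b. Blinfun (\<lambda>v. representation B v b))"
  have c: "blinfun_apply (c b) v = representation B v b" for b v
    unfolding c_def
    by (subst blinfun_apply_Blinfun)
      (auto intro!: linearI simp: representation_add[OF B(2)] representation_scale[OF B(2)] B(3))
  have expand: "v = (\<Sum>b\<in>B. blinfun_apply (c b) v *\<^sub>R b)" for v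
    unfolding c by (rule sum_representation_eq[symmetric]) (use B in auto)
  have "inj (eval_at :: 'a \<Rightarrow> _)"
  proof (rule injI)
    fix x y :: 'a assume "eval_at x = eval_at y"
    then have "blinfun_apply \<xi> x = blinfun_apply \<xi> y" for \<xi> :: "'a dual"
      by (metis eval_at_apply)
    then show "x = y" using expand[of x] expand[of y] by simp
  qed
  moreover have "\<alpha> = eval_at (\<Sum>b\<in>B. blinfun_apply \<alpha> (c b) *\<^sub>R b)" for \<alpha> :: "'a dual dual"
  proof (rule blinfun_eqI)
    fix \<xi> :: "'a dual"
    have "\<xi> = (\<Sum>b\<in>B. blinfun_apply \<xi> b *\<^sub>R c b)"
    proof (rule blinfun_eqI)
      fix v
      have "blinfun_apply \<xi> v = blinfun_apply \<xi> (\<Sum>b\<in>B. blinfun_apply (c b) v *\<^sub>R b)"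
        using expand by metis
      then show "blinfun_apply \<xi> v = blinfun_apply (\<Sum>b\<in>B. blinfun_apply \<xi> b *\<^sub>R c b) v"
        by (simp add: blinfun.bilinear_simps blinfun.sum_left blinfun.sum_right mult.commute)
    qed
    then have "blinfun_apply \<alpha> \<xi> = blinfun_apply \<alpha> (\<Sum>b\<in>B. blinfun_apply \<xi> b *\<^sub>R c b)"
      by simp
    then show "blinfun_apply \<alpha> \<xi> = blinfun_apply (eval_at (\<Sum>b\<in>B. blinfun_apply \<alpha> (c b) *\<^sub>R b)) \<xi>"
      by (simp add: blinfun.bilinear_simps blinfun.sum_left blinfun.sum_right mult.commute)
  qed
  ultimately show ?thesis by (auto simp: bij_def surj_def)
qed

lemma inv_eval_at [simp]: "inv eval_at (eval_at x) = x"
  by (simp add: bij_eval_at bij_is_inj)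

lemma eval_at_inv [simp]: "eval_at (inv eval_at \<alpha>) = \<alpha>"
  by (meson bij_eval_at bij_inv_eq_iff)

lemma linear_inv_eval_at: "linear (inv eval_at :: 'a::finite_dim_space dual dual \<Rightarrow> 'a)"
proof (rule linearI)
  fix \<alpha> \<beta> :: "'a dual dual" and r :: real
  have "eval_at (inv eval_at \<alpha> + inv eval_at \<beta>) = \<alpha> + \<beta>"
    by (simp add: linear_add[OF linear_eval_at])
  then show "inv eval_at (\<alpha> + \<beta>) = inv eval_at \<alpha> + inv eval_at \<beta>"
    by (metis inv_eval_at)
  have "eval_at (r *\<^sub>R inv eval_at \<alpha>) = r *\<^sub>R \<alpha>"
    by (simp add: linear_scale[OF linear_eval_at])
  then show "inv eval_at (r *\<^sub>R \<alpha>) = r *\<^sub>R inv eval_at \<alpha>"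
    by (metis inv_eval_at)
qed

section \<open>Smooth functions and multivectors\<close>

lemma frechet_derivative_affine:
  fixes f :: "'e::finite_dim_space \<Rightarrow> real"
  assumes "linear f"
  shows "frechet_derivative (\<lambda>x. f x + c) (at z) = f"
    and "(\<lambda>x. f x + c) differentiable (at z)"
proof -
  have "((\<lambda>x. f x + c) has_derivative f) (at z)"
    using linear_imp_bounded_linear[OF assms]
    by (auto intro!: derivative_eq_intros bounded_linear_imp_has_derivative)
  then show "frechet_derivative (\<lambda>x. f x + c) (at z) = f"
    and "(\<lambda>x. f x + c) differentiable (at z)"
    by (auto simp: frechet_derivative_at[symmetric] differentiable_def)
qed

lemma smooth_linear:
  fixes f :: "'e::finite_dim_space \<Rightarrow> real"
  assumes "linear f"
  shows "smooth f"
proof -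
  \<comment> \<open>The coinduction runs over affine functions: a directional derivative of a linear
    function is a constant, so linear functions are not closed under differentiation.\<close>
  have "\<exists>g c. linear g \<and> f = (\<lambda>x. g x + c)" using assms by (intro exI[of _ f] exI[of _ 0]) auto
  then show ?thesis
  proof (coinduction arbitrary: f)
    case smooth
    then obtain g c where g: "linear g" "f = (\<lambda>x. g x + c)" by blast
    have "\<exists>h c. linear h \<and> (\<lambda>x. frechet_derivative f (at x) v) = (\<lambda>x. h x + c)" for v
      using g by (intro exI[of _ "\<lambda>_. 0"] exI[of _ "g v"])
        (auto simp: frechet_derivative_affine linear_zero)
    then show ?case using g frechet_derivative_affine(2) by auto
  qed
qed

lemma differential_linear: "linear f \<Longrightarrow> differential f z = Blinfun f"
  using frechet_derivative_affine(1)[of f 0] by (simp add: differential_def)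

section \<open>Alternating forms of degrees two and three\<close>

lemma all_length_2: "(\<forall>as. length as = 2 \<longrightarrow> Q as) \<longleftrightarrow> (\<forall>a b. Q [a, b])"
  by (auto simp: numeral_2_eq_2 length_Suc_conv)

lemma all_length_3: "(\<forall>as. length as = 3 \<longrightarrow> Q as) \<longleftrightarrow> (\<forall>a b c. Q [a, b, c])"
  by (auto simp: numeral_3_eq_3 length_Suc_conv)

text \<open>Serves in both directions: to build the bivector field, and to extract bilinearity and
  alternation from an unknown one in the uniqueness proof.\<close>

lemma multivector_2_iff:
  "multivector 2 P \<longleftrightarrow> (\<forall>as. length as \<noteq> 2 \<longrightarrow> P as = 0) \<and>
    (\<forall>b. linear (\<lambda>a. P [a, b])) \<and> (\<forall>a. linear (\<lambda>b. P [a, b])) \<and> (\<forall>a. P [a, a] = 0)"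
proof -
  have lt: "(\<forall>i<2. Q i) \<longleftrightarrow> Q 0 \<and> Q 1" for Q :: "nat \<Rightarrow> bool"
    by (auto simp: less_2_cases_iff)
  have lt2: "(\<forall>i j. i < j \<and> j < 2 \<longrightarrow> Q i j) \<longleftrightarrow> Q 0 1" for Q :: "nat \<Rightarrow> nat \<Rightarrow> bool"
    by (auto simp: less_2_cases_iff)
  have "multivector 2 P \<longleftrightarrow> (\<forall>as. length as \<noteq> 2 \<longrightarrow> P as = 0) \<and>
      (\<forall>as. length as = 2 \<longrightarrow> (\<forall>i<2. linear (\<lambda>a. P (as[i := a])))) \<and>
      (\<forall>as. length as = 2 \<longrightarrow> (\<forall>i j. i < j \<and> j < 2 \<longrightarrow> as ! i = as ! j \<longrightarrow> P as = 0))"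
    unfolding multivector_def by blast
  then show ?thesis unfolding all_length_2 lt lt2 by auto
qed

lemma multivector_3I:
  assumes "\<And>as. length as \<noteq> 3 \<Longrightarrow> P as = 0"
    and "\<And>b c. linear (\<lambda>a. P [a, b, c])" "\<And>a c. linear (\<lambda>b. P [a, b, c])"
    and "\<And>a b. linear (\<lambda>c. P [a, b, c])"
    and "\<And>a b. P [a, a, b] = 0" "\<And>a b. P [a, b, a] = 0" "\<And>a b. P [b, a, a] = 0"
  shows "multivector 3 P"
proof -
  have lt: "(\<forall>i<3. Q i) \<longleftrightarrow> Q 0 \<and> Q 1 \<and> Q 2" for Q :: "nat \<Rightarrow> bool"
    by (auto simp: numeral_3_eq_3 less_Suc_eq numeral_2_eq_2)
  have lt2: "(\<forall>i j. i < j \<and> j < 3 \<longrightarrow> Q i j) \<longleftrightarrow> Q 0 1 \<and> Q 0 2 \<and> Q 1 2"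
    for Q :: "nat \<Rightarrow> nat \<Rightarrow> bool"
    by (auto simp: numeral_3_eq_3 less_Suc_eq numeral_2_eq_2)
  have "multivector 3 P \<longleftrightarrow> (\<forall>as. length as \<noteq> 3 \<longrightarrow> P as = 0) \<and>
      (\<forall>as. length as = 3 \<longrightarrow> (\<forall>i<3. linear (\<lambda>a. P (as[i := a])))) \<and>
      (\<forall>as. length as = 3 \<longrightarrow> (\<forall>i j. i < j \<and> j < 3 \<longrightarrow> as ! i = as ! j \<longrightarrow> P as = 0))"
    unfolding multivector_def by blast
  then show ?thesis unfolding all_length_3 lt lt2 using assms by auto
qed

text \<open>A permutation of three points with \<open>\<sigma> 0 < \<sigma> 1\<close> is determined
  by \<open>\<sigma> 2\<close>. These three give the terms of the Jacobiator; the composite is the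
  3-cycle sending 0 to 1, 1 to 2 and 2 to 0.\<close>

lemma unshuffles_2_1:
  "unshuffles 2 1 = {id, Transposition.transpose 1 2, Transposition.transpose 0 1 \<circ> Transposition.transpose 1 2}" (is "_ = ?R")
proof -
  have three: "{..<2 + 1} = {0, 1, 2 :: nat}" by auto
  have mono: "strict_mono_on {..<2} \<sigma> \<longleftrightarrow> \<sigma> 0 < \<sigma> (1::nat)" for \<sigma> :: "nat \<Rightarrow> nat"
    by (auto simp: strict_mono_on_def less_2_cases_iff)
  have mono': "strict_mono_on {2..<2 + 1} \<sigma>" for \<sigma> :: "nat \<Rightarrow> nat"
    by (auto simp: strict_mono_on_def)
  have "\<sigma> \<in> ?R" if p: "\<sigma> permutes {0, 1, 2}" and lt: "\<sigma> 0 < \<sigma> 1" for \<sigma> :: "nat \<Rightarrow> nat"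
  proof -
    have eqI: "\<sigma> = \<tau>" if \<tau>: "\<tau> permutes {0, 1, 2}" "\<sigma> 0 = \<tau> 0" "\<sigma> 1 = \<tau> 1" "\<sigma> 2 = \<tau> 2" for \<tau>
    proof
      fix i show "\<sigma> i = \<tau> i"
        using \<tau>(2-4) permutes_not_in[OF p, of i] permutes_not_in[OF \<tau>(1), of i]
        by (cases "i = 0 \<or> i = 1 \<or> i = 2") auto
    qed
    have "\<sigma> i < 3" if "i < 3" for i
      using permutes_in_image[OF p, of i] that by auto
    then have bound: "\<sigma> 0 < 3" "\<sigma> 1 < 3" "\<sigma> 2 < 3" by auto
    have ne: "\<sigma> 0 \<noteq> \<sigma> 2" "\<sigma> 1 \<noteq> \<sigma> 2"
      using permutes_inj[OF p] by (simp_all add: inj_eq)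
    have "\<sigma> 0 = 0 \<and> \<sigma> 1 = 1 \<and> \<sigma> 2 = 2 \<or> \<sigma> 0 = 0 \<and> \<sigma> 1 = 2 \<and> \<sigma> 2 = 1
        \<or> \<sigma> 0 = 1 \<and> \<sigma> 1 = 2 \<and> \<sigma> 2 = 0"
      using lt bound ne by (auto simp: numeral_3_eq_3 less_Suc_eq)
    then consider "\<sigma> 0 = 0" "\<sigma> 1 = 1" "\<sigma> 2 = 2" | "\<sigma> 0 = 0" "\<sigma> 1 = 2" "\<sigma> 2 = 1"
      | "\<sigma> 0 = 1" "\<sigma> 1 = 2" "\<sigma> 2 = 0"
      by metis
    then show ?thesis
    proof cases
      case 1
      then have "\<sigma> = id" by (intro eqI) (auto simp: permutes_id)
      then show ?thesis by simp
    next
      case 2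
      then have "\<sigma> = Transposition.transpose 1 2" by (intro eqI permutes_swap_id) auto
      then show ?thesis by simp
    next
      case 3
      then have "\<sigma> = Transposition.transpose 0 1 \<circ> Transposition.transpose 1 2"
        by (intro eqI permutes_compose permutes_swap_id) auto
      then show ?thesis by simp
    qed
  qed
  moreover have "\<sigma> permutes {0, 1, 2}" "\<sigma> 0 < \<sigma> 1" if "\<sigma> \<in> ?R" for \<sigma> :: "nat \<Rightarrow> nat"
    using that by (auto intro!: permutes_compose permutes_swap_id simp: permutes_id)
  ultimately show ?thesis
    unfolding unshuffles_def mono three using mono' by auto
qed

lemma sum_unshuffles_2_1:
  fixes f :: "(nat \<Rightarrow> nat) \<Rightarrow> real"
  shows "(\<Sum>\<sigma>\<in>unshuffles 2 1. of_int (sign \<sigma>) * f \<sigma>) =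
    f id - f (Transposition.transpose 1 2) + f (Transposition.transpose 0 1 \<circ> Transposition.transpose 1 2)"
proof -
  have "id \<noteq> Transposition.transpose 1 (2::nat)" "id \<noteq> Transposition.transpose 0 1 \<circ> Transposition.transpose 1 (2::nat)"
    "Transposition.transpose 1 2 \<noteq> Transposition.transpose 0 1 \<circ> Transposition.transpose 1 (2::nat)"
    by (auto simp: fun_eq_iff Transposition.transpose_def)
  moreover have "sign (Transposition.transpose 0 1 \<circ> Transposition.transpose 1 (2::nat)) = 1"
    by (simp add: sign_compose permutation_swap_id sign_swap_id)
  ultimately show ?thesis
    unfolding unshuffles_2_1 by (simp add: sign_swap_id)
qed

section \<open>The total bracket\<close>

definition pairing :: "'m \<times> 'x \<Rightarrow> 'm::finite_dim_space dual \<times> 'x::finite_dim_space dual \<Rightarrow> real" where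
  "pairing w z = blinfun_apply (fst z) (fst w) + blinfun_apply (snd z) (snd w)"

definition covector :: "'m \<times> 'x \<Rightarrow> ('m::finite_dim_space dual \<times> 'x::finite_dim_space dual) dual" where
  "covector w = Blinfun (pairing w)"

text \<open>The inverse of \<open>covector\<close>, through the bidual isomorphism on each summand.
  It lets arbitrary covectors be replaced by pairs of algebra elements.\<close>

definition uncovector :: "('m::finite_dim_space dual \<times> 'x::finite_dim_space dual) dual \<Rightarrow> 'm \<times> 'x" where
  "uncovector \<alpha> = (inv eval_at (Blinfun (\<lambda>\<eta>. blinfun_apply \<alpha> (\<eta>, 0))),
    inv eval_at (Blinfun (\<lambda>\<xi>. blinfun_apply \<alpha> (0, \<xi>))))"

lemma linear_pairing: "linear (pairing w)"
  by (auto intro!: linearI simp: pairing_def blinfun.bilinear_simps algebra_simps)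

lemma covector_apply [simp]: "blinfun_apply (covector w) = pairing w"
  by (simp add: covector_def linear_pairing)

lemma linear_slot:
  fixes \<alpha> :: "('a::real_normed_vector \<times> 'b::real_normed_vector) dual"
  shows "linear (\<lambda>\<eta>. blinfun_apply \<alpha> (\<eta>, 0))" "linear (\<lambda>\<xi>. blinfun_apply \<alpha> (0, \<xi>))"
proof -
  have "linear (\<lambda>\<eta>::'a. (\<eta>, 0::'b))" "linear (\<lambda>\<xi>::'b. (0::'a, \<xi>))"
    by (auto intro!: linearI)
  then show "linear (\<lambda>\<eta>. blinfun_apply \<alpha> (\<eta>, 0))" "linear (\<lambda>\<xi>. blinfun_apply \<alpha> (0, \<xi>))"
    using linear_compose[OF _ linear_blinfun_apply[of \<alpha>]] by (auto simp: o_def)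
qed

lemma eval_at_inv_apply: "blinfun_apply \<xi> (inv eval_at \<alpha>) = blinfun_apply \<alpha> \<xi>"
  by (metis eval_at_apply eval_at_inv)

text \<open>Injectivity of \<open>eval_at\<close> as a separation principle: vector identities may
  be checked after pairing with every functional.\<close>

lemma blinfun_separates:
  fixes x y :: "'a::finite_dim_space"
  assumes "\<And>\<xi> :: 'a dual. blinfun_apply \<xi> x = blinfun_apply \<xi> y"
  shows "x = y"
proof -
  have "eval_at x = eval_at y" by (rule blinfun_eqI) (simp add: assms)
  then show ?thesis by (metis inv_eval_at)
qed

lemma covector_uncovector [simp]: "covector (uncovector \<alpha>) = \<alpha>"
proof (rule blinfun_eqI)
  fix z
  have "blinfun_apply (covector (uncovector \<alpha>)) z
      = blinfun_apply \<alpha> (fst z, 0) + blinfun_apply \<alpha> (0, snd z)"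
    by (simp add: pairing_def uncovector_def eval_at_inv_apply linear_slot)
  then show "blinfun_apply (covector (uncovector \<alpha>)) z = blinfun_apply \<alpha> z"
    by (simp flip: blinfun.add_right)
qed

lemma uncovector_covector [simp]: "uncovector (covector w) = w"
proof -
  have "Blinfun (\<lambda>\<eta>. pairing w (\<eta>, 0)) = eval_at (fst w)"
    "Blinfun (\<lambda>\<xi>. pairing w (0, \<xi>)) = eval_at (snd w)"
    by (simp_all add: pairing_def eval_at_def)
  then show ?thesis by (simp add: uncovector_def)
qed

lemma linear_covector: "linear covector"
  by (auto intro!: linearI blinfun_eqI simp: pairing_def blinfun.bilinear_simps algebra_simps)

lemma linear_uncovector: "linear uncovector"
proof (rule linearI)
  fix \<alpha> \<beta> :: "('a dual \<times> 'b dual) dual" and r :: real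
  have "covector (uncovector \<alpha> + uncovector \<beta>) = \<alpha> + \<beta>"
    by (simp add: linear_add[OF linear_covector])
  then show "uncovector (\<alpha> + \<beta>) = uncovector \<alpha> + uncovector \<beta>"
    by (metis uncovector_covector)
  have "covector (r *\<^sub>R uncovector \<alpha>) = r *\<^sub>R \<alpha>"
    by (simp add: linear_scale[OF linear_covector])
  then show "uncovector (r *\<^sub>R \<alpha>) = r *\<^sub>R uncovector \<alpha>"
    by (metis uncovector_covector)
qed

lemma differential_pairing: "differential (pairing w) z = covector w"
  by (simp add: differential_linear linear_pairing covector_def)

lemma fun0_eq_pairing: "fun0 x = pairing (0, x)" and fun1_eq_pairing: "fun1 m = pairing (m, 0)"
  by (auto simp: fun0_def fun1_def pairing_def)

section \<open>The groupoid of the dual complex\<close>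

lemma two_vector_groupoid_linear:
  fixes d :: "'v1::finite_dim_space \<Rightarrow> 'v0::finite_dim_space"
  assumes "linear d"
  shows "two_vector_groupoid d"
  unfolding two_vector_groupoid_def two_vector_space_def
  using assms
  by (auto simp: src_def tgt_def unit_arrow_def arrow_comp_def inv_arrow_def
      linear_add linear_scale linear_0 linear_neg algebra_simps intro!: linearI)

lemma dual_map_apply:
  assumes "linear l1"
  shows "blinfun_apply (dual_map l1 \<xi>) m = - blinfun_apply \<xi> (l1 m)"
  unfolding dual_map_def using assms
  by (subst blinfun_apply_Blinfun)
    (auto intro!: linearI simp: linear_add linear_scale blinfun.bilinear_simps)

lemma linear_dual_map: "linear l1 \<Longrightarrow> linear (dual_map l1)"
  by (auto intro!: linearI blinfun_eqI simp: dual_map_apply blinfun.bilinear_simps)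

section \<open>The bracket of degree 0 and degree -1 elements, and its Jacobiator\<close>

context two_term_Linfty
begin

lemmas l1_simps = linear_0[OF linear_l1] linear_add[OF linear_l1] linear_diff[OF linear_l1]
  linear_neg[OF linear_l1] linear_scale[OF linear_l1]

lemmas l2_simps =
  bilinear_ladd[OF bilinear_l20] bilinear_radd[OF bilinear_l20]
  bilinear_lsub[OF bilinear_l20] bilinear_rsub[OF bilinear_l20]
  bilinear_lneg[OF bilinear_l20] bilinear_rneg[OF bilinear_l20]
  bilinear_lzero[OF bilinear_l20] bilinear_rzero[OF bilinear_l20]
  bilinear_lmul[OF bilinear_l20] bilinear_rmul[OF bilinear_l20]
  bilinear_ladd[OF bilinear_l21] bilinear_radd[OF bilinear_l21]
  bilinear_lsub[OF bilinear_l21] bilinear_rsub[OF bilinear_l21]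
  bilinear_lneg[OF bilinear_l21] bilinear_rneg[OF bilinear_l21]
  bilinear_lzero[OF bilinear_l21] bilinear_rzero[OF bilinear_l21]
  bilinear_lmul[OF bilinear_l21] bilinear_rmul[OF bilinear_l21]

lemmas l3_simps =
  linear_0[OF linear_l3(1)] linear_0[OF linear_l3(2)] linear_0[OF linear_l3(3)]
  linear_add[OF linear_l3(1)] linear_add[OF linear_l3(2)] linear_add[OF linear_l3(3)]
  linear_neg[OF linear_l3(1)] linear_neg[OF linear_l3(2)] linear_neg[OF linear_l3(3)]
  linear_scale[OF linear_l3(1)] linear_scale[OF linear_l3(2)] linear_scale[OF linear_l3(3)]

text \<open>Polarisation of the alternating law at \<open>x + y\<close>.\<close>

lemma l20_skew: "l20 x y = - l20 y x"
proof -
  have "l20 x y + l20 y x = 0"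
    using alternating_l20[of "x + y"] unfolding l2_simps by (simp add: alternating_l20 add.commute)
  then show ?thesis unfolding eq_neg_iff_add_eq_0 .
qed

lemma l3_skew: "l3 x y z = - l3 y x z" "l3 x y z = - l3 x z y"
proof -
  have "l3 x y z + l3 y x z = 0" "l3 x y z + l3 x z y = 0"
    using alternating_l3(1)[of "x + y" z] alternating_l3(3)[of x "y + z"]
    unfolding l3_simps by (simp_all add: alternating_l3) (simp_all add: add.commute)
  then show "l3 x y z = - l3 y x z" "l3 x y z = - l3 x z y"
    unfolding eq_neg_iff_add_eq_0 .
qed

text \<open>This skewness makes the prescribed values of the bivector field on two degree -1
  functions consistent.\<close>

lemma l21_l1_skew: "l21 (l1 m) n = - l21 (l1 n) m"
  using l21_l1[of m n] unfolding swap_bracket_def .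

lemma l21_l1_self: "l21 (l1 m) m = 0"
  \<comment> \<open>A vector equal to its own negative vanishes over the reals.\<close>
  using l21_l1_skew[of m m] unfolding eq_neg_iff_add_eq_0 by (simp flip: scaleR_2)

text \<open>For vanishing \<open>l3\<close> this is the semidirect product Lie algebra of the
  crossed module \<open>l1\<close>, where \<open>l21\<close> is the action and
  \<open>l21 (l1 m) n\<close> the bracket in degree -1.\<close>

definition total_bracket :: "'m \<times> 'x \<Rightarrow> 'm \<times> 'x \<Rightarrow> 'm \<times> 'x" where
  "total_bracket v w = (l21 (snd v) (fst w) - l21 (snd w) (fst v) + l21 (l1 (fst v)) (fst w),
    l20 (snd v) (snd w))"

lemma total_bracket_self: "total_bracket v v = 0"
  by (simp add: total_bracket_def alternating_l20 l21_l1_self zero_prod_def)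

lemma total_bracket_linear: "linear (\<lambda>v. total_bracket v w)" "linear (\<lambda>w. total_bracket v w)"
  by (auto intro!: linearI simp: total_bracket_def l2_simps l1_simps algebra_simps)

text \<open>\<open>Jacobi_1\<close> solved for the action of a bracket: \<open>l3\<close> measures
  the failure of \<open>l21\<close> to be a representation.\<close>

lemma l21_l20: "l21 (l20 x y) m = l21 x (l21 y m) - l21 y (l21 x m) - l3 x y (l1 m)"
  using Jacobi_1[of x y m] by (simp add: swap_bracket_def l2_simps algebra_simps)

text \<open>Skewness brings \<open>l21 x n\<close> under \<open>l1\<close>, equivariance turns it
  into \<open>l20 x (l1 n)\<close>, and \<open>l21_l20\<close> expands the action of that
  bracket.\<close>

lemma l21_l1_l21:
  "l21 (l1 m) (l21 x n) = l21 (l1 n) (l21 x m) - l21 x (l21 (l1 n) m) + l3 x (l1 n) (l1 m)"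
  using l21_l1_skew[of m "l21 x n"] by (simp add: l1_l21 l21_l20)

text \<open>The degree 0 component is \<open>Jacobi_0\<close>. In degree -1 the iterated actions
  cancel by \<open>l21_l20\<close> and skewness; the surviving \<open>l3\<close> terms are the
  multilinear expansion of the second \<open>l3\<close>, without its leading term.\<close>

lemma total_Jacobiator:
  "total_bracket (total_bracket (m, x) (n, y)) (p, z)
    - total_bracket (total_bracket (m, x) (p, z)) (n, y)
    + total_bracket (total_bracket (n, y) (p, z)) (m, x)
    = (l3 x y z - l3 (x + l1 m) (y + l1 n) (z + l1 p), - l1 (l3 x y z))"
proof -
  \<comment> \<open>Unshuffle order has \<open>l20 x z\<close> where cyclic order has
    \<open>l20 z x\<close>, which accounts for the minus sign.\<close>
  have "l20 (l20 x y) z - l20 (l20 x z) y + l20 (l20 y z) x = - l1 (l3 x y z)"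
    using Jacobi_0[of x y z] unfolding l20_skew[of z x] eq_neg_iff_add_eq_0
    by (simp add: l2_simps algebra_simps)
  moreover
  let ?b = "\<lambda>x m y n. l21 x n - l21 y m + l21 (l1 m) n"
  have "?b (l20 x y) (?b x m y n) z p - ?b (l20 x z) (?b x m z p) y n + ?b (l20 y z) (?b y n z p) x m
      = l3 x y z - l3 (x + l1 m) (y + l1 n) (z + l1 p)" (is "?l = ?r")
  \<comment> \<open>Pairing with a covector turns the identity into a real one, so that linear arithmetic can
    eliminate the redundant terms.\<close>
  proof (rule blinfun_separates)
    fix \<eta> :: "'m dual"
    note \<eta> = arg_cong[where f = "blinfun_apply \<eta>"]
    show "blinfun_apply \<eta> ?l = blinfun_apply \<eta> ?r"
      \<comment> \<open>The instances bring all monomials to a common form: the first four move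
        actions past degree -1 brackets, the next six reorder inner brackets, and the rest sort the
        arguments of \<open>l3\<close>.\<close>
      using \<eta>[OF l21_l1_l21[of n x p]] \<eta>[OF l21_l1_l21[of m y p]] \<eta>[OF l21_l1_l21[of m z n]]
        \<eta>[OF l21_l1_l21[of m "l1 n" p]]
        \<eta>[OF arg_cong[OF l21_l1_skew[of n p], of "l21 x"]]
        \<eta>[OF arg_cong[OF l21_l1_skew[of m p], of "l21 y"]]
        \<eta>[OF arg_cong[OF l21_l1_skew[of m n], of "l21 z"]]
        \<eta>[OF arg_cong[OF l21_l1_skew[of n p], of "l21 (l1 m)"]]
        \<eta>[OF arg_cong[OF l21_l1_skew[of m p], of "l21 (l1 n)"]]
        \<eta>[OF arg_cong[OF l21_l1_skew[of m n], of "l21 (l1 p)"]]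
        \<eta>[OF l3_skew(2)[of x "l1 n" z]] \<eta>[OF l3_skew(2)[of x "l1 n" "l1 p"]]
        \<eta>[OF l3_skew(1)[of "l1 m" y z]] \<eta>[OF l3_skew(2)[of y "l1 m" z]]
        \<eta>[OF l3_skew(1)[of "l1 m" y "l1 p"]] \<eta>[OF l3_skew(2)[of y "l1 m" "l1 p"]]
        \<eta>[OF l3_skew(2)[of "l1 m" "l1 n" z]] \<eta>[OF l3_skew(1)[of "l1 m" z "l1 n"]]
        \<eta>[OF l3_skew(2)[of z "l1 m" "l1 n"]]
        \<eta>[OF l3_skew(2)[of "l1 m" "l1 n" "l1 p"]]
        \<eta>[OF l3_skew(1)[of "l1 m" "l1 n" "l1 p"]] \<eta>[OF l3_skew(2)[of "l1 n" "l1 m" "l1 p"]]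
      unfolding l1_simps l2_simps l3_simps l1_l21 l21_l20 blinfun.bilinear_simps
      by linarith
  qed
  ultimately show ?thesis
    by (simp add: total_bracket_def)
qed

section \<open>The bivector field determined by its values on linear functions\<close>

definition dual_bivector ::
  "'m dual \<times> 'x dual \<Rightarrow> ('m dual \<times> 'x dual) dual list \<Rightarrow> real" where
  "dual_bivector z as = (if length as = 2
    then - pairing (total_bracket (uncovector (as ! 0)) (uncovector (as ! 1))) z else 0)"

lemma dual_bivector_apply:
  "dual_bivector z [\<alpha>, \<beta>] = - pairing (total_bracket (uncovector \<alpha>) (uncovector \<beta>)) z"
  by (simp add: dual_bivector_def)

lemma pairing_linear_left: "linear (\<lambda>w. pairing w z)"
  by (auto intro!: linearI simp: pairing_def blinfun.bilinear_simps algebra_simps)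

lemma linear_dual_bivector: "linear (\<lambda>z. dual_bivector z as)"
  by (cases "length as = 2") (auto simp: dual_bivector_def linear_pairing linear_compose_neg linear_zero)

lemma multivector_field_dual_bivector: "multivector_field 2 dual_bivector"
proof -
  have "linear (\<lambda>\<alpha>. dual_bivector z [\<alpha>, \<beta>])" for z \<beta>
    unfolding dual_bivector_apply
    using linear_compose[OF linear_compose[OF linear_uncovector total_bracket_linear(1)] pairing_linear_left]
    by (intro linear_compose_neg) (simp add: o_def)
  moreover have "linear (\<lambda>\<beta>. dual_bivector z [\<alpha>, \<beta>])" for z \<alpha>
    unfolding dual_bivector_apply
    using linear_compose[OF linear_compose[OF linear_uncovector total_bracket_linear(2)] pairing_linear_left]
    by (intro linear_compose_neg) (simp add: o_def)
  ultimately have "multivector 2 (dual_bivector z)" for z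
    unfolding multivector_2_iff
    by (simp add: dual_bivector_def total_bracket_self linear_0[OF pairing_linear_left])
  then show ?thesis
    by (simp add: multivector_section_def smooth_linear linear_dual_bivector)
qed

text \<open>The differentials of \<open>fun0\<close> and \<open>fun1\<close> span all covectors, so
  bilinearity and skewness extend the three prescribed kinds of values uniquely. This settles
  existence and uniqueness together.\<close>

lemma dual_bivector_field_iff: "dual_bivector_field l1 l20 l21 P \<longleftrightarrow> P = dual_bivector"
proof
  assume P: "dual_bivector_field l1 l20 l21 P"
  have mv: "multivector 2 (P z)" for z
    using P unfolding dual_bivector_field_def multivector_section_def by blast
  have lin: "linear (\<lambda>\<alpha>. P z [\<alpha>, \<beta>])" "linear (\<lambda>\<beta>. P z [\<alpha>, \<beta>])"
    and self: "P z [\<alpha>, \<alpha>] = 0" and len: "length as \<noteq> 2 \<Longrightarrow> P z as = 0" for z \<alpha> \<beta> as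
    using mv[of z] by (auto simp: multivector_2_iff)
  \<comment> \<open>Supplies the value on a degree -1 function followed by a degree 0 one, which is
    not among the prescribed kinds.\<close>
  have skew: "P z [\<alpha>, \<beta>] = - P z [\<beta>, \<alpha>]" for z \<alpha> \<beta>
    using self[of z "\<alpha> + \<beta>"] unfolding linear_add[OF lin(1)] linear_add[OF lin(2)]
    by (simp add: self)
  have split: "covector (m, x) = covector (m, 0) + covector (0, x)" for m and x :: 'x
    by (simp flip: linear_add[OF linear_covector])
  have val: "P z [covector (0, x), covector (0, y)] = - pairing (0, l20 x y) z"
    "P z [covector (0, x), covector (m, 0)] = - pairing (l21 x m, 0) z"
    "P z [covector (m, 0), covector (n, 0)] = - pairing (l21 (l1 m) n, 0) z" for z x y m n
    using P unfolding dual_bivector_field_def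
    by (cases z; simp add: differential_pairing fun0_eq_pairing fun1_eq_pairing pairing_def)+
  have "P z [covector (m, x), covector (n, y)] = - pairing (total_bracket (m, x) (n, y)) z"
    for z m n x y
    unfolding split[of m x] split[of n y]
    by (simp add: linear_add[OF lin(1)] linear_add[OF lin(2)] val skew[of z "covector (m, 0)" "covector (0, y)"])
      (simp add: pairing_def total_bracket_def blinfun.bilinear_simps)
  then have "P z [\<alpha>, \<beta>] = dual_bivector z [\<alpha>, \<beta>]" for z \<alpha> \<beta>
    by (metis dual_bivector_apply covector_uncovector surj_pair)
  then have "P z as = dual_bivector z as" for z as
  proof (cases "length as = 2")
    case True
    then obtain \<alpha> \<beta> where "as = [\<alpha>, \<beta>]" by (auto simp: numeral_2_eq_2 length_Suc_conv)
    then show ?thesis using \<open>P z [\<alpha>, \<beta>] = dual_bivector z [\<alpha>, \<beta>]\<close> by simp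
  qed (simp add: len dual_bivector_def)
  then show "P = dual_bivector" by blast
next
  assume "P = dual_bivector"
  then show "dual_bivector_field l1 l20 l21 P"
    using multivector_field_dual_bivector
    by (auto simp: dual_bivector_field_def differential_pairing fun0_eq_pairing fun1_eq_pairing
        pairing_def dual_bivector_apply total_bracket_def l2_simps l1_simps)
qed

end

section \<open>The quasi-Poisson identities\<close>

text \<open>In this and the next two lemmas only the argument lists are unrolled. The sums over
  unshuffles stay intact, ready to be compared with \<open>coherence\<close> in total degree
  four.\<close>

lemma multiderivation_comp_2_2:
  "multiderivation_comp 2 2 P Q x as = (\<Sum>\<sigma>\<in>unshuffles 2 1. of_int (sign \<sigma>) *
    P x [differential (\<lambda>y. Q y [as ! \<sigma> 0, as ! \<sigma> 1]) x, as ! \<sigma> 2])"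
  by (simp add: multiderivation_comp_def upt_rec numeral_2_eq_2)

lemma multiderivation_comp_2_3:
  "multiderivation_comp 2 3 P Q x as = (\<Sum>\<sigma>\<in>unshuffles 3 1. of_int (sign \<sigma>) *
    P x [differential (\<lambda>y. Q y [as ! \<sigma> 0, as ! \<sigma> 1, as ! \<sigma> 2]) x, as ! \<sigma> 3])"
  by (simp add: multiderivation_comp_def upt_rec numeral_2_eq_2 numeral_3_eq_3)

lemma multiderivation_comp_3_2:
  "multiderivation_comp 3 2 P Q x as = (\<Sum>\<sigma>\<in>unshuffles 2 2. of_int (sign \<sigma>) *
    P x [differential (\<lambda>y. Q y [as ! \<sigma> 0, as ! \<sigma> 1]) x, as ! \<sigma> 2, as ! \<sigma> 3])"
  by (simp add: multiderivation_comp_def upt_rec numeral_2_eq_2 numeral_3_eq_3)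

lemma covector_comp_left:
  fixes w :: "'m::finite_dim_space \<times> 'x::finite_dim_space"
  shows "covector w o\<^sub>L Blinfun (\<lambda>e. (0, e)) = eval_at (snd w)"
proof (rule blinfun_eqI)
  fix e
  have "linear (\<lambda>e. (0 :: 'm dual, e :: 'x dual))" by (auto intro!: linearI)
  then show "blinfun_apply (covector w o\<^sub>L Blinfun (\<lambda>e. (0, e))) e = blinfun_apply (eval_at (snd w)) e"
    by (simp add: pairing_def)
qed

text \<open>The minus sign of the right translation cancels the one in \<open>dual_map\<close>,
  whence the term \<open>+ l1 (fst w)\<close>.\<close>

lemma covector_comp_right:
  assumes "linear l1"
  shows "covector w o\<^sub>L Blinfun (\<lambda>e. (- dual_map l1 e, e)) = eval_at (snd w + l1 (fst w))"
proof (rule blinfun_eqI)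
  fix e
  have "linear (\<lambda>e. (- dual_map l1 e, e))"
    using linear_dual_map[OF assms] by (auto intro!: linearI simp: linear_add linear_scale)
  then show "blinfun_apply (covector w o\<^sub>L Blinfun (\<lambda>e. (- dual_map l1 e, e))) e
      = blinfun_apply (eval_at (snd w + l1 (fst w))) e"
    by (simp add: pairing_def blinfun.bilinear_simps dual_map_apply[OF assms])
qed

section \<open>Tangent vectors of the multiplication graph and the splitting of covectors\<close>

lemma affine_tangent_vector:
  assumes "\<And>t. p + t *\<^sub>R v \<in> S"
  shows "v \<in> tangent_vectors S p"
proof -
  have "((\<lambda>t. p + t *\<^sub>R v) has_vector_derivative v) (at 0)"
    by (auto intro!: derivative_eq_intros)
  then show ?thesis
    unfolding tangent_vectors_def using assms
    by (intro CollectI exI[of _ "\<lambda>t. p + t *\<^sub>R v"]) auto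
qed

text \<open>The graph is a linear subspace and these triples are its elements, so the line through
  \<open>p\<close> in such a direction stays in the graph.\<close>

lemma mult_graph_tangent:
  assumes "linear d" "p \<in> mult_graph d"
  shows "((a, b), (a + d b, c), (a, b + c)) \<in> tangent_vectors (mult_graph d) p"
proof (rule affine_tangent_vector)
  fix t :: real
  show "p + t *\<^sub>R ((a, b), (a + d b, c), (a, b + c)) \<in> mult_graph d"
    using assms
    by (auto simp: mult_graph_def tgt_def src_def arrow_comp_def linear_add linear_scale algebra_simps)
qed

lemma triple_dual_decompose:
  fixes \<alpha> :: "('g::finite_dim_space \<times> 'g \<times> 'g) dual"
  shows "blinfun_apply \<alpha> (a, b, c) = blinfun_apply (\<alpha> o\<^sub>L Blinfun (\<lambda>a. (a, 0, 0))) a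
    + blinfun_apply (\<alpha> o\<^sub>L Blinfun (\<lambda>a. (0, a, 0))) b + blinfun_apply (\<alpha> o\<^sub>L Blinfun (\<lambda>a. (0, 0, a))) c"
proof -
  have "linear (\<lambda>a::'g. (a, 0::'g, 0::'g))" "linear (\<lambda>a::'g. (0::'g, a, 0::'g))"
    "linear (\<lambda>a::'g. (0::'g, 0::'g, a))"
    by (auto intro!: linearI)
  then show ?thesis by (simp flip: blinfun.add_right)
qed

text \<open>Multilinearity and alternation of \<open>l3\<close> carry over through the linear map
  \<open>inv eval_at\<close>; smoothness comes from linearity in the base point.\<close>

lemma multivector_section_minus_l3:
  assumes "two_term_Linfty l1 l20 l21 l3"
  shows "multivector_section 3 (minus_l3_section l3)" "linear (\<lambda>\<eta>. minus_l3_section l3 \<eta> as)"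
proof -
  interpret two_term_Linfty l1 l20 l21 l3 by fact
  show lin: "linear (\<lambda>\<eta>. minus_l3_section l3 \<eta> as)" for as
    by (auto intro!: linearI simp: minus_l3_section_def blinfun.bilinear_simps)
  have "multivector 3 (minus_l3_section l3 \<eta>)" for \<eta>
    by (rule multivector_3I)
      (auto intro!: linearI simp: minus_l3_section_def alternating_l3 l3_simps
        linear_add[OF linear_inv_eval_at] linear_scale[OF linear_inv_eval_at] blinfun.bilinear_simps)
  then show "multivector_section 3 (minus_l3_section l3)"
    by (simp add: multivector_section_def smooth_linear lin)
qed

section \<open>Schouten identities and multiplicativity for the dual bivector field\<close>

context two_term_Linfty
begin

lemma dual_bivector_covector:
  "dual_bivector z [covector v, covector w] = - pairing (total_bracket v w) z"
  by (simp add: dual_bivector_apply)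

text \<open>On constant covectors the bivector field is a linear function of the point, so its
  differential is constant. Nested derivations thereby become iterated brackets.\<close>

lemma differential_dual_bivector:
  "differential (\<lambda>z. dual_bivector z [covector v, covector w]) z = covector (- total_bracket v w)"
  unfolding dual_bivector_covector
  by (simp add: linear_neg[OF pairing_linear_left, symmetric] differential_pairing)

text \<open>Evaluation at the target of \<open>z\<close> is transposed into a single element paired
  with \<open>z\<close>, so that the differential can be read off.\<close>

lemma left_translation_minus_l3:
  "left_translation (dual_map l1) (minus_l3_section l3) z [covector u, covector v, covector w]
    = pairing (- l3 (snd u) (snd v) (snd w), l1 (l3 (snd u) (snd v) (snd w))) z"
  by (simp add: left_translation_def pushforward_def covector_comp_left minus_l3_section_def
      tgt_def pairing_def dual_map_apply linear_l1 blinfun.bilinear_simps)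

lemma right_translation_minus_l3:
  "right_translation (dual_map l1) (minus_l3_section l3) z [covector u, covector v, covector w]
    = pairing (- l3 (snd u + l1 (fst u)) (snd v + l1 (fst v)) (snd w + l1 (fst w)), 0) z"
  by (simp add: right_translation_def pushforward_def covector_comp_right linear_l1
      minus_l3_section_def src_def pairing_def blinfun.bilinear_simps)

lemma half_schouten_dual_bivector:
  "1 / 2 * schouten 2 2 dual_bivector dual_bivector z as
    = left_translation (dual_map l1) (minus_l3_section l3) z as
      - right_translation (dual_map l1) (minus_l3_section l3) z as"
proof (cases "length as = 3")
  case False
  then show ?thesis
    by (simp add: schouten_def left_translation_def right_translation_def pushforward_def
        minus_l3_section_def)
next
  case True
  then obtain \<alpha> \<beta> \<gamma> where "as = [\<alpha>, \<beta>, \<gamma>]"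
    by (auto simp: numeral_3_eq_3 length_Suc_conv)
  then obtain u v w where as: "as = [covector u, covector v, covector w]"
    by (metis covector_uncovector)
  obtain m x n y p z' where uvw: "u = (m, x)" "v = (n, y)" "w = (p, z')"
    by (metis surj_pair)
  \<comment> \<open>The degree sign is -1, so the two compositions add up and half the bracket is
    minus one composition. In each term the two minus signs of the bivector field cancel.\<close>
  have "1 / 2 * schouten 2 2 dual_bivector dual_bivector z as
      = - (pairing (total_bracket (total_bracket u v) w) z - pairing (total_bracket (total_bracket u w) v) z
        + pairing (total_bracket (total_bracket v w) u) z)"
    unfolding schouten_def multiderivation_comp_2_2 sum_unshuffles_2_1
    by (simp add: as differential_dual_bivector)
      (simp add: dual_bivector_covector linear_neg[OF total_bracket_linear(1)] linear_neg[OF pairing_linear_left])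
  also have "\<dots> = - pairing (l3 x y z' - l3 (x + l1 m) (y + l1 n) (z' + l1 p), - l1 (l3 x y z')) z"
    unfolding total_Jacobiator[symmetric] uvw
    by (simp only: linear_add[OF pairing_linear_left] linear_diff[OF pairing_linear_left])
  also have "\<dots> = left_translation (dual_map l1) (minus_l3_section l3) z as
      - right_translation (dual_map l1) (minus_l3_section l3) z as"
    unfolding as left_translation_minus_l3 right_translation_minus_l3 uvw
    by (simp add: pairing_def blinfun.bilinear_simps)
  finally show ?thesis .
qed

text \<open>Here the degree sign is +1, and the two compositions are \<theta>, the target of
  \<open>z\<close>, applied to the two sides of \<open>coherence\<close>.\<close>

lemma schouten_dual_bivector_left_translation:
  "schouten 2 3 dual_bivector (left_translation (dual_map l1) (minus_l3_section l3)) z as = 0"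
proof -
  let ?Q = "left_translation (dual_map l1) (minus_l3_section l3)"
  define us where "us = (\<lambda>i. uncovector (as ! i))"
  define xs where "xs = (\<lambda>i. snd (us i))"
  define \<theta> where "\<theta> = tgt (dual_map l1) z"
  have as: "as ! i = covector (us i)" for i by (simp add: us_def)
  \<comment> \<open>Elements of the form \<open>(- m, l1 m)\<close> see only the target of an arrow;
    differentials of left translations have this form.\<close>
  have pair: "pairing (- m, l1 m) z = - blinfun_apply \<theta> m" for m
    by (simp add: \<theta>_def tgt_def pairing_def dual_map_apply linear_l1 blinfun.bilinear_simps)
  have "dual_bivector z [differential (\<lambda>y. ?Q y [as ! i, as ! j, as ! k]) z, as ! h]
      = blinfun_apply \<theta> (swap_bracket l21 (l3 (xs i) (xs j) (xs k)) (xs h))" for i j k h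
  proof -
    let ?l = "l3 (xs i) (xs j) (xs k)"
    \<comment> \<open>The terms in \<open>fst (us h)\<close> cancel, and the result again has the
      form \<open>(- m, l1 m)\<close>, with \<open>m = - l21 (xs h) ?l\<close>.\<close>
    have "total_bracket (- ?l, l1 ?l) (us h) = (l21 (xs h) ?l, - l1 (l21 (xs h) ?l))"
      using l20_skew[of "l1 ?l" "xs h"]
      by (simp add: total_bracket_def xs_def l2_simps l1_simps l1_l21)
    then show ?thesis
      using pair[of "- l21 (xs h) ?l"]
      unfolding as left_translation_minus_l3 differential_pairing dual_bivector_covector
      by (simp add: xs_def l1_simps swap_bracket_def blinfun.bilinear_simps)
  qed
  then have "multiderivation_comp 2 3 dual_bivector ?Q z as
      = blinfun_apply \<theta> (\<Sum>\<tau>\<in>unshuffles 3 1. of_int (sign \<tau>) *\<^sub>R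
          swap_bracket l21 (l3 (xs (\<tau> 0)) (xs (\<tau> 1)) (xs (\<tau> 2))) (xs (\<tau> 3)))"
    by (simp add: multiderivation_comp_2_3 blinfun.sum_right blinfun.scaleR_right)
  \<comment> \<open>Only the degree 0 component of the bracket enters \<open>l3\<close>; its minus
    sign cancels that of the trisection.\<close>
  moreover have "?Q z [differential (\<lambda>y. dual_bivector y [as ! i, as ! j]) z, as ! k, as ! h]
      = blinfun_apply \<theta> (l3 (l20 (xs i) (xs j)) (xs k) (xs h))" for i j k h
    unfolding as differential_dual_bivector left_translation_minus_l3 pair
    by (simp add: total_bracket_def l3_simps xs_def blinfun.bilinear_simps)
  then have "multiderivation_comp 3 2 ?Q dual_bivector z as
      = blinfun_apply \<theta> (\<Sum>\<sigma>\<in>unshuffles 2 2. of_int (sign \<sigma>) *\<^sub>R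
          l3 (l20 (xs (\<sigma> 0)) (xs (\<sigma> 1))) (xs (\<sigma> 2)) (xs (\<sigma> 3)))"
    by (simp add: multiderivation_comp_3_2 blinfun.sum_right blinfun.scaleR_right)
  ultimately show ?thesis
    by (simp only: schouten_def coherence) simp
qed

lemma multiplicative_dual_bivector: "multiplicative_bivector (dual_map l1) dual_bivector"
  unfolding multiplicative_bivector_def coisotropic_def
proof (intro ballI allI impI, elim conjE)
  fix p and \<alpha> \<beta> :: "(('m dual \<times> 'x dual) \<times> ('m dual \<times> 'x dual) \<times> ('m dual \<times> 'x dual)) dual"
  assume p: "p \<in> mult_graph (dual_map l1)"
    and \<alpha>: "\<forall>v\<in>tangent_vectors (mult_graph (dual_map l1)) p. blinfun_apply \<alpha> v = 0"
    and \<beta>: "\<forall>v\<in>tangent_vectors (mult_graph (dual_map l1)) p. blinfun_apply \<beta> v = 0"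
  have conormal: "\<exists>m k x.
      \<gamma> o\<^sub>L Blinfun (\<lambda>a. (a, 0, 0)) = covector (k - m, x + l1 m) \<and>
      \<gamma> o\<^sub>L Blinfun (\<lambda>a. (0, a, 0)) = covector (m, x) \<and>
      \<gamma> o\<^sub>L Blinfun (\<lambda>a. (0, 0, a)) = covector (- k, - x)"
    if \<gamma>: "\<forall>v\<in>tangent_vectors (mult_graph (dual_map l1)) p. blinfun_apply \<gamma> v = 0" for \<gamma>
  proof -
    obtain m1 x1 m2 x2 m3 x3 where u:
      "\<gamma> o\<^sub>L Blinfun (\<lambda>a. (a, 0, 0)) = covector (m1, x1)"
      "\<gamma> o\<^sub>L Blinfun (\<lambda>a. (0, a, 0)) = covector (m2, x2)"
      "\<gamma> o\<^sub>L Blinfun (\<lambda>a. (0, 0, a)) = covector (m3, x3)"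
      by (metis covector_uncovector surj_pair)
    have eq: "pairing (m1, x1) (a, b) + pairing (m2, x2) (a + dual_map l1 b, c)
        + pairing (m3, x3) (a, b + c) = 0" for a b c
      using \<gamma> mult_graph_tangent[OF linear_dual_map[OF linear_l1] p, of a b c]
        triple_dual_decompose[of \<gamma> "(a, b)" "(a + dual_map l1 b, c)" "(a, b + c)"]
      by (simp add: u)
    \<comment> \<open>Keeping one of the parameters \<open>a\<close>, \<open>b\<close>,
      \<open>c\<close> of the tangent vector at a time yields the three equations of the conormal
      space.\<close>
    have "m1 = - m3 - m2"
    proof (rule blinfun_separates)
      fix a :: "'m dual"
      show "blinfun_apply a m1 = blinfun_apply a (- m3 - m2)"
        using eq[of a 0 0]
        by (simp add: pairing_def blinfun.bilinear_simps linear_0[OF linear_dual_map[OF linear_l1]])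
    qed
    moreover have "x1 = - x3 + l1 m2"
    proof (rule blinfun_separates)
      fix b :: "'x dual"
      show "blinfun_apply b x1 = blinfun_apply b (- x3 + l1 m2)"
        using eq[of 0 b 0]
        by (simp add: pairing_def blinfun.bilinear_simps dual_map_apply linear_l1)
    qed
    moreover have "x2 = - x3"
    proof (rule blinfun_separates)
      fix c :: "'x dual"
      show "blinfun_apply c x2 = blinfun_apply c (- x3)"
        using eq[of 0 0 c]
        by (simp add: pairing_def blinfun.bilinear_simps linear_0[OF linear_dual_map[OF linear_l1]])
    qed
    ultimately show ?thesis
      using u by (intro exI[of _ m2] exI[of _ "- m3"] exI[of _ x2]) simp
  qed
  obtain m k x where a:
    "\<alpha> o\<^sub>L Blinfun (\<lambda>a. (a, 0, 0)) = covector (k - m, x + l1 m)"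
    "\<alpha> o\<^sub>L Blinfun (\<lambda>a. (0, a, 0)) = covector (m, x)"
    "\<alpha> o\<^sub>L Blinfun (\<lambda>a. (0, 0, a)) = covector (- k, - x)"
    using conormal[OF \<alpha>] by blast
  obtain n j y where b:
    "\<beta> o\<^sub>L Blinfun (\<lambda>a. (a, 0, 0)) = covector (j - n, y + l1 n)"
    "\<beta> o\<^sub>L Blinfun (\<lambda>a. (0, a, 0)) = covector (n, y)"
    "\<beta> o\<^sub>L Blinfun (\<lambda>a. (0, 0, a)) = covector (- j, - y)"
    using conormal[OF \<beta>] by blast
  obtain \<eta> \<xi> \<xi>' where p': "p = ((\<eta>, \<xi>), (\<eta> + dual_map l1 \<xi>, \<xi>'), (\<eta>, \<xi> + \<xi>'))"
    using p by (auto simp: mult_graph_def tgt_def src_def arrow_comp_def)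
  \<comment> \<open>The terms at \<xi>' cancel outright. Those at \<eta> cancel by skewness of
    \<open>l21 (l1 m) n\<close>, those at \<xi> by skewness of \<open>l20\<close>, once
    \<open>l1_l21\<close> has rewritten what \<open>dual_map\<close> produces at the middle
    factor.\<close>
  show "triple_bivector dual_bivector p [\<alpha>, \<beta>] = 0"
    using arg_cong[where f = "blinfun_apply \<eta>", OF l21_l1_skew[of m n]]
      arg_cong[where f = "blinfun_apply \<eta>", OF l21_l1_skew[of k n]]
      arg_cong[where f = "blinfun_apply \<xi>", OF l20_skew[of "l1 m" y]]
    unfolding p' triple_bivector_def pushforward_def case_prod_conv list.map a b
      dual_bivector_covector total_bracket_def pairing_def fst_conv snd_conv
      l1_simps l2_simps l1_l21 blinfun.bilinear_simps dual_map_apply[OF linear_l1]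
    by linarith
qed

end

theorem theorem5p9:
  fixes l1 :: "'m::finite_dim_space \<Rightarrow> 'x::finite_dim_space"
    and l20 :: "'x \<Rightarrow> 'x \<Rightarrow> 'x"
    and l21 :: "'x \<Rightarrow> 'm \<Rightarrow> 'm"
    and l3 :: "'x \<Rightarrow> 'x \<Rightarrow> 'x \<Rightarrow> 'm"
  assumes "two_term_Linfty l1 l20 l21 l3"
  shows "(\<exists>!P. dual_bivector_field l1 l20 l21 P) \<and>
    (\<forall>P. dual_bivector_field l1 l20 l21 P \<longrightarrow>
      Lie_quasi_Poisson_groupoid (dual_map l1) P (minus_l3_section l3))"
proof -
  interpret two_term_Linfty l1 l20 l21 l3 by fact
  have "Lie_quasi_Poisson_groupoid (dual_map l1) dual_bivector (minus_l3_section l3)"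
    unfolding Lie_quasi_Poisson_groupoid_def quasi_Poisson_groupoid_def
    using two_vector_groupoid_linear[OF linear_dual_map[OF linear_l1]]
      multivector_field_dual_bivector multiplicative_dual_bivector
      multivector_section_minus_l3[OF assms] half_schouten_dual_bivector
      schouten_dual_bivector_left_translation linear_dual_bivector
    by blast
  then show ?thesis
    unfolding dual_bivector_field_iff by simp
qed

end
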